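(* Let $\boldsymbol\lambda$ be a partition of $n$ and let $K$ be a $p$-adic field. Then $$\zeta_{\mathsf N(\boldsymbol\lambda^* ),\mathfrak O_K}(s) = W_{\boldsymbol\lambda}(q_K,q_K^{-s}).$$
   Context: A $p$-adic field is a finite extension $K$ of $\mathbf Q_p$ for some prime $p$; $\mathfrak O_K$ is its valuation ring and $q_K$ its residue field size. Let $n\ge1$. For $A\in\mathrm M_n(\mathfrak O_K)$, acting on row vectors by right multiplication, $\zeta_{A,\mathfrak O_K}(s)=\sum_{m\ge1}a_m m^{-s}$, where $a_m$ is the number of $A$-invariant $\mathfrak O_K$-submodules of $\mathfrak O_K^n$ of index $m$. A partition of $n$ is a non-increasing sequence $\boldsymbol\lambda=(\lambda_1,\dots,\lambda_r)$ of positive integers with sum $n$. For $1\le j\le n$, $\boldsymbol\lambda^{-1}(j)=\min\{i\in\{1,\dots,r\}: j\le\lambda_1+\dots+\lambda_i\}$. The dual partition is $\boldsymbol\lambda^*=(\mu_1,\dots,\mu_{\lambda_1})$ with $\mu_i=\#\{j:\lambda_j\ge i\}$. $\mathsf N(\boldsymbol\lambda)$ denotes the nilpotent block diagonal matrix $\mathrm{diag}(\mathsf C(X^{\lambda_1}),\dots,\mathsf C(X^{\lambda_r}))$, where $\mathsf C(X^m)$ is the $m\times m$ matrix with ones on the superdiagonal and zeros elsewhere. Define $$W_{\boldsymbol\lambda}(X,Y)=\frac{1}{\prod_{j=1}^n\bigl(1-X^{j-1}Y^{\boldsymbol\lambda^{-1}(j)}\bigr)}\in\mathbf Q(X,Y).$$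 *)

theory Defs
  imports
    "HOL-Analysis.Complex_Transcendental"
    "HOL-Computational_Algebra.Fraction_Field"
    "Berlekamp_Zassenhaus.Finite_Field"
    "Jordan_Normal_Form.Matrix"
begin

unbundle no vec_syntax
hide_const (open) Finite_Cartesian_Product.vec
hide_type (open) Finite_Cartesian_Product.vec

section \<open>The \<open>p\<close>-adic numbers\<close>

text \<open>
  The prime \<open>p\<close> is the cardinality of the index type \<open>'p\<close>.  The ring of \<open>p\<close>-adic integers is the
  inverse limit of the rings \<open>\<int>/p\<^sup>n\<close>, residues being represented by \<open>0, \<dots>, p\<^sup>n - 1\<close>; the
  compatibility condition below already forces \<open>x n\<close> to lie in this range.
\<close>

typedef (overloaded) 'p padic_int =
  "{x :: nat \<Rightarrow> int. \<forall>n. x (Suc n) mod int CARD('p::prime_card) ^ n = x n}"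
  by (rule exI[of _ "\<lambda>_. 0"]) simp

setup_lifting type_definition_padic_int

lemma padic_mod_step:
  "a mod int CARD('p::prime_card) ^ Suc n mod int CARD('p) ^ n = a mod int CARD('p) ^ n"
  by (rule mod_mod_cancel) simp

instantiation padic_int :: (prime_card) comm_ring_1
begin

lift_definition zero_padic_int :: "'a padic_int" is "\<lambda>_. 0" by simp

lift_definition one_padic_int :: "'a padic_int" is "\<lambda>n. 1 mod int CARD('a) ^ n"
  by (simp only: padic_mod_step)

lift_definition plus_padic_int :: "'a padic_int \<Rightarrow> 'a padic_int \<Rightarrow> 'a padic_int"
  is "\<lambda>x y n. (x n + y n) mod int CARD('a) ^ n"
  by (simp only: padic_mod_step) (metis mod_add_eq)

lift_definition minus_padic_int :: "'a padic_int \<Rightarrow> 'a padic_int \<Rightarrow> 'a padic_int"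
  is "\<lambda>x y n. (x n - y n) mod int CARD('a) ^ n"
  by (simp only: padic_mod_step) (metis mod_diff_eq)

lift_definition uminus_padic_int :: "'a padic_int \<Rightarrow> 'a padic_int"
  is "\<lambda>x n. (- x n) mod int CARD('a) ^ n"
  by (simp only: padic_mod_step) (metis mod_minus_eq)

lift_definition times_padic_int :: "'a padic_int \<Rightarrow> 'a padic_int \<Rightarrow> 'a padic_int"
  is "\<lambda>x y n. (x n * y n) mod int CARD('a) ^ n"
  by (simp only: padic_mod_step) (metis mod_mult_eq)

instance
proof
  fix a b c :: "'a padic_int"
  show "a + b + c = a + (b + c)" by transfer (simp add: mod_simps add.assoc)
  show "a + b = b + a" by transfer (simp add: add.commute)
  show "0 + a = a" by transfer (auto simp: fun_eq_iff, metis mod_mod_trivial)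
  show "- a + a = 0" by transfer (simp add: mod_simps)
  show "a - b = a + - b" by transfer (simp add: mod_simps)
  show "a * b * c = a * (b * c)" by transfer (simp add: mod_simps mult.assoc)
  show "a * b = b * a" by transfer (simp add: mult.commute)
  show "1 * a = a" by transfer (auto simp: fun_eq_iff mod_simps, metis mod_mod_trivial)
  show "(a + b) * c = a * c + b * c" by transfer (simp add: mod_simps distrib_right)
  have "(1::int) < int CARD('a)" using prime_card prime_gt_1_nat by auto
  then have "1 mod int CARD('a) ^ 1 \<noteq> (0::int)" by simp
  then show "(0::'a padic_int) \<noteq> 1" by transfer (metis)
qed

end

text \<open>For \<open>x \<noteq> 0\<close>, this is the largest \<open>n\<close> such that \<open>x\<close> vanishes modulo \<open>p\<^sup>n\<close>.\<close>

definition padic_ord :: "'p::prime_card padic_int \<Rightarrow> nat"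
  where "padic_ord x = (LEAST n. Rep_padic_int x (Suc n) \<noteq> 0)"

lemma Rep_padic_int_Suc_mod:
  "Rep_padic_int (x :: 'p::prime_card padic_int) (Suc n) mod int CARD('p) ^ n = Rep_padic_int x n"
  using Rep_padic_int[of x] by blast

lemma Rep_padic_int_mod:
  assumes "m \<le> n"
  shows "Rep_padic_int (x :: 'p::prime_card padic_int) n mod int CARD('p) ^ m = Rep_padic_int x m"
  using assms
proof (induction n rule: dec_induct)
  case base
  have "Rep_padic_int x (Suc m) mod int CARD('p) ^ m mod int CARD('p) ^ m
      = Rep_padic_int x (Suc m) mod int CARD('p) ^ m"
    by (rule mod_mod_trivial)
  then show ?case unfolding Rep_padic_int_Suc_mod .
next
  case (step n)
  have "Rep_padic_int x (Suc n) mod int CARD('p) ^ m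
      = Rep_padic_int x (Suc n) mod int CARD('p) ^ n mod int CARD('p) ^ m"
    using step(1) by (simp add: mod_mod_cancel le_imp_power_dvd)
  then show ?case unfolding Rep_padic_int_Suc_mod using step by simp
qed

lemma Rep_padic_int_eq_0_iff:
  assumes "x \<noteq> (0 :: 'p::prime_card padic_int)"
  shows "Rep_padic_int x n = 0 \<longleftrightarrow> n \<le> padic_ord x"
proof -
  have zero: "Rep_padic_int x 0 = 0" using Rep_padic_int_Suc_mod[of x 0] by simp
  have "Rep_padic_int x \<noteq> (\<lambda>_. 0)"
    using assms Rep_padic_int_inject[of x 0] by (simp add: zero_padic_int.rep_eq)
  then obtain k where k: "Rep_padic_int x k \<noteq> 0" by blast
  then obtain k' where "Rep_padic_int x (Suc k') \<noteq> 0" using zero by (cases k) auto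
  then have ne: "Rep_padic_int x (Suc (padic_ord x)) \<noteq> 0"
    unfolding padic_ord_def by (rule LeastI)
  have below: "Rep_padic_int x (padic_ord x) = 0"
  proof (cases "padic_ord x")
    case (Suc m)
    then have "m < (LEAST n. Rep_padic_int x (Suc n) \<noteq> 0)" by (simp add: padic_ord_def)
    from not_less_Least[OF this] show ?thesis by (simp add: Suc)
  qed (simp add: zero)
  show ?thesis
  proof (cases "n \<le> padic_ord x")
    case True
    from Rep_padic_int_mod[OF this, of x] have "Rep_padic_int x n = 0" unfolding below by simp
    with True show ?thesis by simp
  next
    case False
    then have "Suc (padic_ord x) \<le> n" by simp
    from Rep_padic_int_mod[OF this, of x] ne have "Rep_padic_int x n \<noteq> 0" by fastforce
    with False show ?thesis by simp
  qed
qed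

lemma padic_ord_dvd_iff:
  assumes "x \<noteq> (0 :: 'p::prime_card padic_int)" "m \<le> n"
  shows "int CARD('p) ^ m dvd Rep_padic_int x n \<longleftrightarrow> m \<le> padic_ord x"
  using Rep_padic_int_mod[OF assms(2), of x] Rep_padic_int_eq_0_iff[OF assms(1), of m]
  by (simp add: dvd_eq_mod_eq_0)

lemma padic_mult_aux:
  assumes "x \<noteq> (0 :: 'p::prime_card padic_int)" "y \<noteq> 0"
  shows "Rep_padic_int (x * y) n = 0 \<longleftrightarrow> n \<le> padic_ord x + padic_ord y"
proof -
  let ?p = "int CARD('p)"
  define i j where "i = padic_ord x" and "j = padic_ord y"
  define N where "N = Suc (i + j + n)"
  have p: "prime ?p" by (rule prime_card_int)
  have p0: "?p \<noteq> 0" using p by auto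
  obtain u where u: "Rep_padic_int x N = ?p ^ i * u"
    using padic_ord_dvd_iff[OF assms(1), of i N] by (auto simp: i_def N_def dvd_def)
  obtain w where w: "Rep_padic_int y N = ?p ^ j * w"
    using padic_ord_dvd_iff[OF assms(2), of j N] by (auto simp: j_def N_def dvd_def)
  have "\<not> ?p dvd u"
  proof
    assume "?p dvd u"
    then have "?p ^ Suc i dvd Rep_padic_int x N" by (auto simp: u dvd_def)
    then show False using padic_ord_dvd_iff[OF assms(1), of "Suc i" N] by (simp add: i_def N_def)
  qed
  moreover have "\<not> ?p dvd w"
  proof
    assume "?p dvd w"
    then have "?p ^ Suc j dvd Rep_padic_int y N" by (auto simp: w dvd_def)
    then show False using padic_ord_dvd_iff[OF assms(2), of "Suc j" N] by (simp add: j_def N_def)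
  qed
  ultimately have uw: "\<not> ?p dvd u * w" using p by (simp add: prime_dvd_mult_iff)
  have eq: "Rep_padic_int x N * Rep_padic_int y N = ?p ^ (i + j) * (u * w)"
    by (simp add: u w power_add)
  have "Rep_padic_int (x * y) n = Rep_padic_int (x * y) N mod ?p ^ n"
    using Rep_padic_int_mod[of n N "x * y"] by (simp add: N_def)
  also have "\<dots> = (Rep_padic_int x N * Rep_padic_int y N) mod ?p ^ N mod ?p ^ n"
    by (simp add: times_padic_int.rep_eq)
  also have "\<dots> = (?p ^ (i + j) * (u * w)) mod ?p ^ n"
    unfolding eq by (rule mod_mod_cancel) (simp add: N_def le_imp_power_dvd)
  finally have "Rep_padic_int (x * y) n = 0 \<longleftrightarrow> ?p ^ n dvd ?p ^ (i + j) * (u * w)"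
    by (simp add: dvd_eq_mod_eq_0)
  also have "\<dots> \<longleftrightarrow> n \<le> i + j"
  proof
    assume "n \<le> i + j"
    then show "?p ^ n dvd ?p ^ (i + j) * (u * w)" by (simp add: le_imp_power_dvd)
  next
    assume d: "?p ^ n dvd ?p ^ (i + j) * (u * w)"
    show "n \<le> i + j"
    proof (rule ccontr)
      assume "\<not> n \<le> i + j"
      then have "?p ^ (Suc (i + j)) dvd ?p ^ n" by (intro le_imp_power_dvd) simp
      then have "?p ^ (i + j) * ?p dvd ?p ^ (i + j) * (u * w)"
        using d dvd_trans by (metis power_Suc2)
      then have "?p dvd u * w" using p0 by simp
      then show False using uw by simp
    qed
  qed
  finally show ?thesis by (simp add: i_def j_def)
qed

instance padic_int :: (prime_card) idom
proof
  fix a b :: "'a padic_int"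
  assume "a \<noteq> 0" "b \<noteq> 0"
  then have "Rep_padic_int (a * b) (Suc (padic_ord a + padic_ord b)) \<noteq> 0"
    using padic_mult_aux[of a b] by simp
  then show "a * b \<noteq> 0" by (auto simp: zero_padic_int.rep_eq)
qed

lemma padic_ord_mult:
  assumes "x \<noteq> (0 :: 'p::prime_card padic_int)" "y \<noteq> 0"
  shows "padic_ord (x * y) = padic_ord x + padic_ord y"
proof -
  have "n \<le> padic_ord (x * y) \<longleftrightarrow> n \<le> padic_ord x + padic_ord y" for n
    using padic_mult_aux[OF assms, of n] Rep_padic_int_eq_0_iff[of "x * y" n] assms by simp
  then show ?thesis by (meson order.antisym order.refl)
qed

definition padic_int_abs :: "'p::prime_card padic_int \<Rightarrow> real"
  where "padic_int_abs x = (if x = 0 then 0 else 1 / real CARD('p) ^ padic_ord x)"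

lemma padic_int_abs_mult: "padic_int_abs (x * y) = padic_int_abs x * padic_int_abs y"
  by (simp add: padic_int_abs_def padic_ord_mult power_add)

lemma padic_int_abs_eq_0_iff [simp]: "padic_int_abs x = 0 \<longleftrightarrow> x = 0"
proof -
  have "CARD('a) \<noteq> 0" using prime_card prime_gt_0_nat by (metis less_irrefl)
  then show ?thesis by (simp add: padic_int_abs_def)
qed

type_synonym 'p padic = "'p padic_int fract"

definition padic_abs :: "'p::prime_card padic \<Rightarrow> real"
  where "padic_abs x =
    (THE r. \<exists>a b. b \<noteq> 0 \<and> x = Fract a b \<and> r = padic_int_abs a / padic_int_abs b)"

lemma padic_abs_Fract:
  fixes a b :: "'p::prime_card padic_int"
  assumes "b \<noteq> 0"
  shows "padic_abs (Fract a b) = padic_int_abs a / padic_int_abs b"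
  unfolding padic_abs_def
proof (rule the_equality)
  fix r
  assume "\<exists>c d. d \<noteq> 0 \<and> Fract a b = Fract c d \<and> r = padic_int_abs c / padic_int_abs d"
  then obtain c d where "d \<noteq> 0" "a * d = c * b" and r: "r = padic_int_abs c / padic_int_abs d"
    using assms by (auto simp: eq_fract)
  then show "r = padic_int_abs a / padic_int_abs b"
    using assms by (metis frac_eq_eq padic_int_abs_eq_0_iff padic_int_abs_mult)
qed (use assms in blast)

section \<open>Finite extensions of the \<open>p\<close>-adic numbers\<close>

definition nonarch_absolute_value :: "('k::field \<Rightarrow> real) \<Rightarrow> bool"
  where "nonarch_absolute_value v \<longleftrightarrow>
    (\<forall>x. 0 \<le> v x) \<and> (\<forall>x. v x = 0 \<longleftrightarrow> x = 0) \<and>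
    (\<forall>x y. v (x * y) = v x * v y) \<and> (\<forall>x y. v (x + y) \<le> max (v x) (v y))"

text \<open>
  The field \<open>'k\<close> is a finite extension of the \<open>p\<close>-adic numbers via \<open>\<iota>\<close>, and \<open>v\<close> is the (unique)
  absolute value on it that extends the \<open>p\<close>-adic one.
\<close>

definition padic_field :: "('p::prime_card padic \<Rightarrow> 'k::field) \<Rightarrow> ('k \<Rightarrow> real) \<Rightarrow> bool"
  where "padic_field \<iota> v \<longleftrightarrow>
    field_hom \<iota> \<and>
    (\<exists>B. finite_dimensional_vector_space (\<lambda>c x. \<iota> c * x) B) \<and>
    nonarch_absolute_value v \<and> (\<forall>c. v (\<iota> c) = padic_abs c)"

definition valuation_ring :: "('k::field \<Rightarrow> real) \<Rightarrow> 'k set"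
  where "valuation_ring v = {x. v x \<le> 1}"

text \<open>Cardinality of the quotient of the valuation ring by its maximal ideal \<open>{x. v x < 1}\<close>.\<close>

definition residue_field_size :: "('k::field \<Rightarrow> real) \<Rightarrow> nat"
  where "residue_field_size v =
    card (valuation_ring v // {(x, y). x \<in> valuation_ring v \<and> y \<in> valuation_ring v \<and> v (x - y) < 1})"

section \<open>Submodules invariant under a matrix and their zeta function\<close>

definition free_module :: "'k::field set \<Rightarrow> nat \<Rightarrow> 'k vec set"
  where "free_module R n = {x \<in> carrier_vec n. \<forall>i<n. vec_index x i \<in> R}"

definition row_mult :: "'k::field vec \<Rightarrow> 'k mat \<Rightarrow> 'k vec"
  where "row_mult x A = vec (dim_col A) (\<lambda>j. scalar_prod x (col A j))"

definition invariant_submodule :: "'k::field set \<Rightarrow> 'k mat \<Rightarrow> 'k vec set \<Rightarrow> bool"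
  where "invariant_submodule R A M \<longleftrightarrow>
    M \<subseteq> free_module R (dim_row A) \<and> 0\<^sub>v (dim_row A) \<in> M \<and>
    (\<forall>x\<in>M. \<forall>y\<in>M. x + y \<in> M) \<and> (\<forall>c\<in>R. \<forall>x\<in>M. c \<cdot>\<^sub>v x \<in> M) \<and>
    (\<forall>x\<in>M. row_mult x A \<in> M)"

text \<open>By the convention on \<open>card\<close>, submodules of infinite index get the value \<open>0\<close>.\<close>

definition submodule_index :: "'k::field set \<Rightarrow> nat \<Rightarrow> 'k vec set \<Rightarrow> nat"
  where "submodule_index R n M =
    card (free_module R n // {(x, y). x \<in> free_module R n \<and> y \<in> free_module R n \<and> x - y \<in> M})"

definition invariant_submodules_of_index :: "'k::field set \<Rightarrow> 'k mat \<Rightarrow> nat \<Rightarrow> 'k vec set set"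
  where "invariant_submodules_of_index R A m =
    {M. invariant_submodule R A M \<and> submodule_index R (dim_row A) M = m}"

text \<open>Shifted indexing: the \<open>k\<close>-th term is \<open>a\<^sub>m m\<^sup>-\<^sup>s\<close> for \<open>m = k + 1\<close>.\<close>

definition submodule_zeta_term :: "'k::field set \<Rightarrow> 'k mat \<Rightarrow> complex \<Rightarrow> nat \<Rightarrow> complex"
  where "submodule_zeta_term R A s k =
    of_nat (card (invariant_submodules_of_index R A (Suc k))) * of_nat (Suc k) powr (- s)"

definition submodule_zeta :: "'k::field set \<Rightarrow> 'k mat \<Rightarrow> complex \<Rightarrow> complex"
  where "submodule_zeta R A s = (\<Sum>k. submodule_zeta_term R A s k)"

section \<open>Partitions\<close>

definition is_partition :: "nat \<Rightarrow> nat list \<Rightarrow> bool"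
  where "is_partition n l \<longleftrightarrow> sorted_wrt (\<ge>) l \<and> (\<forall>x\<in>set l. 0 < x) \<and> sum_list l = n"

definition partition_inv :: "nat list \<Rightarrow> nat \<Rightarrow> nat"
  where "partition_inv l j = Min {i \<in> {1..length l}. j \<le> sum_list (take i l)}"

text \<open>Used for nonempty lists only; \<open>hd l\<close> is then the largest part.\<close>

definition dual_partition :: "nat list \<Rightarrow> nat list"
  where "dual_partition l = map (\<lambda>i. length (filter (\<lambda>x. i \<le> x) l)) [1..<Suc (hd l)]"

definition companion_X_power :: "nat \<Rightarrow> 'k::field mat"
  where "companion_X_power m = mat m m (\<lambda>(i, j). if j = Suc i then 1 else 0)"

definition nilpotent_matrix :: "nat list \<Rightarrow> 'k::field mat"
  where "nilpotent_matrix l = diag_block_mat (map companion_X_power l)"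

text \<open>The bivariate rational function, as the function it induces on a field.\<close>

definition W :: "nat list \<Rightarrow> 'a::field \<Rightarrow> 'a \<Rightarrow> 'a"
  where "W l X Y = 1 / (\<Prod>j = 1..sum_list l. 1 - X ^ (j - 1) * Y ^ partition_inv l j)"

end

theory Submission
  imports Defs "HOL-Library.Function_Algebras" "HOL-Complex_Analysis.Cauchy_Integral_Formula"
begin

hide_const (open) Finite_Cartesian_Product.vec
hide_type (open) Finite_Cartesian_Product.vec

text \<open>
  Number the standard basis by the cells of the Young diagram of \<open>l\<close>, lowest row first and each
  row from left to right; the nilpotent matrix then moves a cell to the one below it, i.e. acts as
  \<open>x \<mapsto> x \<circ> h\<close> where \<open>h\<close> is the move to the cell above, which is strictly increasing. An invariant
  submodule \<open>M\<close> of rank \<open>m + 1\<close> is determined by its intersection \<open>M'\<close> with the span \<open>V m\<close> of the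
  first \<open>m\<close> basis vectors, by the exponent \<open>k\<close> of the last diagonal entry of its Hermite normal form,
  and by a class \<open>b\<close> in \<open>V m / M'\<close> that satisfies the linear equation \<open>N b = - t\<^sup>k N e\<^bsub>m\<^esub>\<close>. If it is
  solvable, it has as many solutions as \<open>N\<close> has cokernel elements on \<open>V m / M'\<close>, and both this number
  and the solvability depend only on \<open>k\<close> and the diagonal exponents of \<open>M'\<close>. Hence, after giving every
  diagonal exponent its own variable, the generating function for \<open>m + 1\<close> is a geometric series times
  the one for \<open>m\<close> with modified variables, and peeling off the basis vectors one by one gives the
  product. All sums are taken in the extended nonnegative reals at a small real argument, and the
  resulting identity of power series is transferred to the complex plane.
\<close>

section \<open>Transversals\<close>

text \<open>Monotonicity of \<open>h\<close> is what makes the peeling possible. It forces the image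
  of \<open>V m\<close> under the shift to be an initial segment \<open>V (c m)\<close>, so that
  image and submodule can be compared through last coordinates, and the cokernel on
  \<open>V m / M'\<close> sees only the exponents from \<open>c m\<close> on. The numbering by
  Jordan blocks can violate this, because the end of one block leaves the basis while later blocks
  still move inside it. Rows of the Young diagram interleave the blocks, and as they are ordered by
  length the move upwards is monotone. A single variable would not be stable under the recursion:
  removing a basis vector multiplies the variables from \<open>c m\<close> on by \<open>q\<close>
  and may merge the removed variable into the one of \<open>c m\<close>. The merging runs along the
  columns, which is why the exponent of \<open>Y\<close> in a factor is a row number. Extended
  nonnegative values allow regrouping before anything is known to be finite; finiteness of the
  counts is then read off from the value of the product. Quotients are replaced by sets of
  representatives, which can be counted coordinate by coordinate.\<close>

definition transversal :: "'a::ab_group_add set \<Rightarrow> 'a set \<Rightarrow> 'a set \<Rightarrow> bool"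
  where "transversal A B T \<longleftrightarrow> T \<subseteq> A \<and> (\<forall>a\<in>A. \<exists>!t. t \<in> T \<and> a - t \<in> B)"

definition add_subgroup :: "'a::ab_group_add set \<Rightarrow> bool"
  where "add_subgroup A \<longleftrightarrow> 0 \<in> A \<and> (\<forall>x\<in>A. \<forall>y\<in>A. x - y \<in> A)"

lemma add_subgroup_uminus: "add_subgroup A \<Longrightarrow> x \<in> A \<Longrightarrow> - x \<in> A"
  unfolding add_subgroup_def by (metis diff_0)

lemma add_subgroup_add: "add_subgroup A \<Longrightarrow> x \<in> A \<Longrightarrow> y \<in> A \<Longrightarrow> x + y \<in> A"
  using add_subgroup_uminus[of A y] unfolding add_subgroup_def by (metis diff_minus_eq_add)

lemma add_subgroup_diff: "add_subgroup A \<Longrightarrow> x \<in> A \<Longrightarrow> y \<in> A \<Longrightarrow> x - y \<in> A"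
  unfolding add_subgroup_def by blast

lemma add_subgroup_minus_commute: "add_subgroup A \<Longrightarrow> x - y \<in> A \<Longrightarrow> y - x \<in> A"
  using add_subgroup_uminus[of A "x - y"] by simp

lemma add_subgroup_diff_trans: "add_subgroup A \<Longrightarrow> x - y \<in> A \<Longrightarrow> y - z \<in> A \<Longrightarrow> x - z \<in> A"
  using add_subgroup_add[of A "x - y" "y - z"] by simp

lemma transversalD:
  assumes "transversal A B T" "s \<in> T" "t \<in> T" "s - t \<in> B" "add_subgroup B"
  shows "s = t"
proof -
  have "s \<in> A" "s - s \<in> B" using assms by (auto simp: transversal_def add_subgroup_def)
  then show ?thesis using assms unfolding transversal_def by blast
qed

lemma transversalE:
  assumes "transversal A B T" "a \<in> A"
  obtains t where "t \<in> T" "a - t \<in> B"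
  using assms unfolding transversal_def by blast

lemma transversalI:
  assumes "T \<subseteq> A" "\<And>a. a \<in> A \<Longrightarrow> \<exists>t\<in>T. a - t \<in> B"
    "\<And>s t. s \<in> T \<Longrightarrow> t \<in> T \<Longrightarrow> s - t \<in> B \<Longrightarrow> s = t" "add_subgroup B"
  shows "transversal A B T"
  unfolding transversal_def
proof (intro conjI ballI)
  fix a assume "a \<in> A"
  then obtain t where t: "t \<in> T" "a - t \<in> B" using assms by blast
  show "\<exists>!t. t \<in> T \<and> a - t \<in> B"
  proof (rule ex1I[of _ t])
    fix s assume s: "s \<in> T \<and> a - s \<in> B"
    then have "s - t \<in> B"
      using add_subgroup_diff[OF assms(4), of "a - t" "a - s"] t by simp
    with assms(3) s t show "s = t" by blast
  qed (use t in blast)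
qed (rule assms)

lemma bij_betw_quotient_transversal:
  assumes "transversal A B T" "add_subgroup B"
  shows "bij_betw (\<lambda>t. {(x, y). x \<in> A \<and> y \<in> A \<and> x - y \<in> B} `` {t}) T
    (A // {(x, y). x \<in> A \<and> y \<in> A \<and> x - y \<in> B})"
proof -
  let ?r = "{(x, y). x \<in> A \<and> y \<in> A \<and> x - y \<in> B}"
  have TA: "T \<subseteq> A" using assms by (simp add: transversal_def)
  have eq: "?r `` {s} = ?r `` {t} \<longleftrightarrow> s - t \<in> B" if "s \<in> A" "t \<in> A" for s t
  proof
    assume "?r `` {s} = ?r `` {t}"
    moreover have "t \<in> ?r `` {t}" using that assms(2) by (auto simp: add_subgroup_def)
    ultimately show "s - t \<in> B" by auto
  next
    assume st: "s - t \<in> B"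
    have "s - x \<in> B \<longleftrightarrow> t - x \<in> B" for x
      using add_subgroup_diff_trans[OF assms(2) st, of x] add_subgroup_minus_commute[OF assms(2) st]
        add_subgroup_diff_trans[OF assms(2), of t s x] by blast
    then show "?r `` {s} = ?r `` {t}" using that by auto
  qed
  show ?thesis
    unfolding bij_betw_def
  proof
    show "inj_on (\<lambda>t. ?r `` {t}) T"
      using eq TA transversalD[OF assms(1) _ _ _ assms(2)] by (meson inj_onI subsetD)
    show "(\<lambda>t. ?r `` {t}) ` T = A // ?r"
    proof (intro equalityI subsetI)
      fix C assume "C \<in> A // ?r"
      then obtain a where a: "a \<in> A" "C = ?r `` {a}" by (auto simp: quotient_def)
      then obtain t where "t \<in> T" "a - t \<in> B" using transversalE[OF assms(1)] by blast
      then show "C \<in> (\<lambda>t. ?r `` {t}) ` T" using eq[of a t] a TA by blast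
    qed (use TA in \<open>auto simp: quotient_def\<close>)
  qed
qed

text \<open>Elements of one coset satisfy the same choice predicate, so Hilbert choice returns the
  same representative for all of them; the image of the choice function is the transversal.\<close>

lemma ex_transversal:
  assumes "add_subgroup B"
  shows "\<exists>T. transversal A B T"
proof -
  define f where "f a = (SOME x. x \<in> A \<and> a - x \<in> B)" for a
  have f: "f a \<in> A \<and> a - f a \<in> B" if "a \<in> A" for a
  proof -
    have "\<exists>x. x \<in> A \<and> a - x \<in> B" using that assms by (auto simp: add_subgroup_def)
    then show ?thesis unfolding f_def by (rule someI_ex)
  qed
  have cong: "f a = f b" if "a - b \<in> B" for a b
  proof -
    have "a - x \<in> B \<longleftrightarrow> b - x \<in> B" for x
      using add_subgroup_diff_trans[OF assms that, of x] add_subgroup_minus_commute[OF assms that]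
        add_subgroup_diff_trans[OF assms, of b a x] by blast
    then show ?thesis by (simp add: f_def)
  qed
  have "transversal A B (f ` A)"
  proof (rule transversalI[OF _ _ _ assms])
    fix s t assume "s \<in> f ` A" "t \<in> f ` A" and st: "s - t \<in> B"
    then obtain a b where ab: "a \<in> A" "b \<in> A" "s = f a" "t = f b" by blast
    have "f b - b \<in> B" using f ab add_subgroup_minus_commute[OF assms] by blast
    then have "s - b \<in> B" using add_subgroup_diff_trans[OF assms st] ab by simp
    then have "a - b \<in> B" using add_subgroup_diff_trans[OF assms, of a s b] f ab by simp
    then show "s = t" using cong ab by simp
  qed (use f in auto)
  then show ?thesis ..
qed

text \<open>A solution set of \<open>N t = b\<close> modulo \<open>B\<close> is empty or a coset of the kernel, and all the
  fibres over \<open>C/(B \<inter> C)\<close> have the same size.\<close>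

lemma card_transversal_fibre:
  fixes N :: "'a::ab_group_add \<Rightarrow> 'a"
  assumes A: "add_subgroup A" and B: "add_subgroup B" and C: "add_subgroup C"
    and T: "transversal A B T" and U: "transversal C (B \<inter> C) U"
    and N_diff: "\<And>x y. N (x - y) = N x - N y"
    and NA: "N ` A = C" and NB: "N ` B \<subseteq> B" and BA: "B \<subseteq> A" and CA: "C \<subseteq> A"
    and fin: "finite T" and f: "f \<in> A"
  shows "card {t \<in> T. N t - f \<in> B} * card U = (if \<exists>c\<in>C. f - c \<in> B then card T else 0)"
proof (cases "\<exists>c\<in>C. f - c \<in> B")
  case False
  have "N t - f \<notin> B" if "t \<in> T" for t
    using False NA T that add_subgroup_minus_commute[OF B, of "N t" f] unfolding transversal_def by blast
  then have "{t \<in> T. N t - f \<in> B} = {}" by blast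
  then show ?thesis using False by (simp only: if_False card.empty mult_0)
next
  case True
  note swap = add_subgroup_minus_commute[OF B] and trans = add_subgroup_diff_trans[OF B]
  have TA: "T \<subseteq> A" using T by (simp add: transversal_def)
  have BC: "add_subgroup (B \<inter> C)" using B C by (auto simp: add_subgroup_def)
  define X where "X b = {t \<in> T. N t - b \<in> B}" for b
  have N_B: "N x - N y \<in> B" if "x - y \<in> B" for x y
    using NB that N_diff by (metis image_subset_iff)
  \<comment> \<open>Translation by a preimage \<open>d\<close> of \<open>c - b\<close>, followed by
    reduction to the representative in \<open>T\<close>, embeds the fibre over \<open>b\<close> into
    the fibre over \<open>c\<close>. By symmetry all fibres are equally large.\<close>
  have le: "card (X b) \<le> card (X c)" if bc: "b \<in> C" "c \<in> C" for b c
  proof -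
    have "c - b \<in> C" using bc C by (simp add: add_subgroup_diff)
    then obtain d where d: "d \<in> A" "N d = c - b" using NA by (metis imageE)
    define g where "g t = (SOME s. s \<in> T \<and> (t + d) - s \<in> B)" for t
    have g: "g t \<in> T \<and> (t + d) - g t \<in> B" if "t \<in> T" for t
    proof -
      have "t + d \<in> A" using that TA d add_subgroup_add[OF A] by blast
      then have "\<exists>s. s \<in> T \<and> (t + d) - s \<in> B" using transversalE[OF T] by metis
      then show ?thesis unfolding g_def by (rule someI_ex)
    qed
    have "g t \<in> X c" if "t \<in> X b" for t
    proof -
      have t: "t \<in> T" "N t - b \<in> B" using that by (auto simp: X_def)
      have "N (t + d) - N (g t) \<in> B" using g[OF t(1)] by (intro N_B) simp
      moreover have "N (t + d) - N d = N t" using N_diff[of "t + d" d] by simp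
      ultimately have "(N t + (c - b)) - N (g t) \<in> B" using d by (metis diff_add_cancel)
      then have "N (g t) - (N t + (c - b)) \<in> B" by (rule swap)
      then have "(N (g t) - (N t + (c - b))) + (N t - b) \<in> B" using t add_subgroup_add[OF B] by blast
      moreover have "(N (g t) - (N t + (c - b))) + (N t - b) = N (g t) - c" by (simp add: algebra_simps)
      ultimately show ?thesis using g[OF t(1)] by (simp add: X_def)
    qed
    moreover have "inj_on g (X b)"
    proof (rule inj_onI)
      fix s t assume st: "s \<in> X b" "t \<in> X b" "g s = g t"
      then have "s \<in> T" "t \<in> T" by (auto simp: X_def)
      then have "((s + d) - g s) - ((t + d) - g t) \<in> B"
        using g add_subgroup_diff[OF B] by blast
      then have "s - t \<in> B" using st by simp
      with \<open>s \<in> T\<close> \<open>t \<in> T\<close> show "s = t" using transversalD[OF T _ _ _ B] by blast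
    qed
    moreover have "finite (X c)" using fin by (simp add: X_def)
    ultimately show ?thesis by (intro card_inj_on_le[of g]) auto
  qed
  obtain c0 where c0: "c0 \<in> C" "f - c0 \<in> B" using True by blast
  have Xf: "{t \<in> T. N t - f \<in> B} = X c0"
    unfolding X_def using trans c0 swap by blast
  have UC: "U \<subseteq> C" using U by (simp add: transversal_def)
  have T_eq: "T = (\<Union>b\<in>U. X b)"
  proof (intro equalityI subsetI)
    fix t assume t: "t \<in> T"
    then have "N t \<in> C" using NA TA by blast
    then obtain b where "b \<in> U" "N t - b \<in> B \<inter> C" using transversalE[OF U] by blast
    then show "t \<in> (\<Union>b\<in>U. X b)" using t by (auto simp: X_def)
  qed (auto simp: X_def)
  have disj: "X b \<inter> X c = {}" if "b \<in> U" "c \<in> U" "b \<noteq> c" for b c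
  proof (rule ccontr)
    assume "X b \<inter> X c \<noteq> {}"
    then obtain t where "N t - b \<in> B" "N t - c \<in> B" by (auto simp: X_def)
    then have "b - c \<in> B" using swap trans by blast
    moreover have "b - c \<in> C" using that UC add_subgroup_diff[OF C] by blast
    ultimately show False using transversalD[OF U that(1,2) _ BC] that(3) by blast
  qed
  have cX: "card (X b) = card (X c0)" if "b \<in> U" for b
    using that UC c0 le by (meson order.antisym subsetD)
  \<comment> \<open>The fibres over \<open>U\<close> are nonempty and pairwise disjoint subsets of
    the finite set \<open>T\<close>, so finiteness of \<open>U\<close> is inherited from
    \<open>T\<close>.\<close>
  have finU: "finite U"
  proof -
    have ne: "X b \<noteq> {}" if b: "b \<in> U" for b
    proof -
      obtain d where d: "d \<in> A" "N d = b" using b UC NA by (metis imageE subsetD)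
      then obtain t where t: "t \<in> T" "d - t \<in> B" using transversalE[OF T] by blast
      then have "b - N t \<in> B" using N_B d by blast
      then show ?thesis using t swap by (auto simp: X_def)
    qed
    have "inj_on X U" using disj ne by (metis inf.idem inj_onI)
    moreover have "X ` U \<subseteq> Pow T" by (auto simp: X_def)
    ultimately show ?thesis using fin by (meson finite_Pow_iff inj_on_finite)
  qed
  have "finite (X b)" for b using fin by (simp add: X_def)
  then have "card (\<Union>b\<in>U. X b) = (\<Sum>b\<in>U. card (X b))"
    using finU disj by (intro card_UN_disjoint) auto
  then have "card T = card U * card (X c0)" using cX T_eq by simp
  then show ?thesis using True Xf by simp
qed

section \<open>Valuations with finite residue field\<close>

locale nonarch_valuation =
  fixes v :: "'k::field \<Rightarrow> real"
  assumes nonarch: "nonarch_absolute_value v"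
begin

lemma v_nonneg [simp]: "0 \<le> v x"
  and v_eq_0 [simp]: "v x = 0 \<longleftrightarrow> x = 0"
  and v_mult: "v (x * y) = v x * v y"
  and v_add: "v (x + y) \<le> max (v x) (v y)"
  using nonarch by (auto simp: nonarch_absolute_value_def)

lemma v_0 [simp]: "v 0 = 0" by simp

lemma v_pos [simp]: "0 < v x \<longleftrightarrow> x \<noteq> 0"
  using v_nonneg[of x] v_eq_0[of x] by linarith

lemma v_1 [simp]: "v 1 = 1"
  using v_mult[of 1 1] v_eq_0[of 1] by simp

lemma v_minus [simp]: "v (- x) = v x"
proof -
  have "v (- 1) * v (- 1) = 1" using v_mult[of "- 1" "- 1"] by simp
  then have "v (- 1) = 1" using v_nonneg[of "- 1"] by (metis abs_of_nonneg abs_square_eq_1 power2_eq_square)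
  then show ?thesis using v_mult[of "- 1" x] by simp
qed

lemma v_diff: "v (x - y) \<le> max (v x) (v y)"
  using v_add[of x "- y"] by simp

lemma v_power: "v (x ^ n) = v x ^ n"
  by (induction n) (simp_all add: v_mult)

lemma v_divide: "v (x / y) = v x / v y"
proof (cases "y = 0")
  case False
  then have "v (x / y) * v y = v x" using v_mult[of "x / y" y] by simp
  then show ?thesis using False by (simp add: field_simps)
qed simp

lemma v_sum_le:
  assumes "\<And>i. i \<in> I \<Longrightarrow> v (f i) \<le> B" "0 \<le> B"
  shows "v (\<Sum>i\<in>I. f i) \<le> B"
  using assms
proof (induction I rule: infinite_finite_induct)
  case (insert i I)
  then have "v (f i) \<le> B" "v (\<Sum>i\<in>I. f i) \<le> B" by auto
  then show ?case using insert.hyps v_add[of "f i" "\<Sum>i\<in>I. f i"] by simp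
qed simp_all

end


text \<open>A discrete valuation with finite residue field: \<open>t_max\<close> says that no value
  lies strictly between \<open>v t\<close> and 1, so \<open>t\<close> is a uniformizer.\<close>

locale finite_residue_valuation = nonarch_valuation v for v :: "'k::field \<Rightarrow> real" +
  fixes t :: 'k
  assumes t_pos: "0 < v t" and t_less_1: "v t < 1"
    and t_max: "\<And>x. v x < 1 \<Longrightarrow> v x \<le> v t"
    and finite_residue: "finite (valuation_ring v //
      {(x, y). x \<in> valuation_ring v \<and> y \<in> valuation_ring v \<and> v (x - y) < 1})"
begin

abbreviation "R \<equiv> valuation_ring v"
abbreviation "q \<equiv> residue_field_size v"

lemma t_nonzero [simp]: "t \<noteq> 0"
  using t_pos by auto

text \<open>The \<open>k\<close>-th power of the maximal ideal, described by values;
  \<open>P_eq_mult\<close> identifies it with the multiples of \<open>t ^ k\<close> in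
  \<open>R\<close>.\<close>

definition P :: "nat \<Rightarrow> 'k set"
  where "P k = {x. v x \<le> v t ^ k}"

lemma R_eq_P: "R = P 0"
  by (simp add: valuation_ring_def P_def)

lemma subgroup_P [simp]: "add_subgroup (P k)"
  unfolding add_subgroup_def
proof (intro conjI ballI)
  fix x y assume "x \<in> P k" "y \<in> P k"
  then show "x - y \<in> P k" using v_diff[of x y] by (simp add: P_def)
qed (simp add: P_def t_pos less_imp_le)

lemma subgroup_R [simp]: "add_subgroup R"
  by (simp add: R_eq_P)

lemma R_0 [simp]: "0 \<in> R" and R_1 [simp]: "1 \<in> R"
  and R_add: "x \<in> R \<Longrightarrow> y \<in> R \<Longrightarrow> x + y \<in> R"
  and R_diff: "x \<in> R \<Longrightarrow> y \<in> R \<Longrightarrow> x - y \<in> R"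
  and R_uminus: "x \<in> R \<Longrightarrow> - x \<in> R"
  and R_mult: "x \<in> R \<Longrightarrow> y \<in> R \<Longrightarrow> x * y \<in> R"
  using add_subgroup_add[OF subgroup_R] add_subgroup_diff[OF subgroup_R]
  by (simp_all) (simp_all add: valuation_ring_def v_mult mult_le_one)

lemma t_power_R [simp]: "t ^ k \<in> R"
  by (simp add: valuation_ring_def v_power power_le_one t_less_1 less_imp_le)

lemma t_power_P: "t ^ j \<in> P k \<longleftrightarrow> k \<le> j"
  using power_decreasing_iff[OF t_pos t_less_1] by (auto simp: P_def v_power)

lemma P_mono: "j \<le> k \<Longrightarrow> P k \<subseteq> P j"
  unfolding P_def using power_decreasing_iff[OF t_pos t_less_1, of k j] by auto

lemma P_eq_mult: "P k = {t ^ k * r | r. r \<in> R}"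
proof (intro equalityI subsetI)
  fix x assume "x \<in> P k"
  then have "x / t ^ k \<in> R" 
    by (simp add: P_def valuation_ring_def v_divide v_power divide_le_eq_1 t_pos)
  moreover have "x = t ^ k * (x / t ^ k)" by simp
  ultimately show "x \<in> {t ^ k * r | r. r \<in> R}" by blast
qed (auto simp: P_def valuation_ring_def v_mult v_power mult_left_le)

lemma P_inj: "P j = P k \<Longrightarrow> j = k"
  using t_power_P by (metis order.antisym order.refl)

text \<open>Take the first power of \<open>v t\<close> below \<open>v x\<close>. If
  \<open>v x\<close> were smaller than the preceding power \<open>v t ^ j\<close>, then
  \<open>x / t ^ j\<close> would have value below 1, hence at most \<open>v t\<close>, against the
  choice of that first power.\<close>

lemma value_is_power:
  assumes "x \<in> R" "x \<noteq> 0"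
  obtains k where "v x = v t ^ k"
proof -
  have "(\<lambda>k. v t ^ k) \<longlonglongrightarrow> 0" using t_pos t_less_1 by (intro LIMSEQ_realpow_zero) auto
  then have "\<forall>\<^sub>F k in sequentially. v t ^ k < v x"
    using assms by (intro order_tendstoD) auto
  then obtain N where N: "v t ^ N < v x" by (auto simp: eventually_sequentially)
  define k where "k = (LEAST k. v t ^ k < v x)"
  have k: "v t ^ k < v x" unfolding k_def using N by (rule LeastI)
  have "k \<noteq> 0" using k assms by (auto simp: valuation_ring_def intro: gr0I)
  then obtain j where j: "k = Suc j" by (cases k) auto
  then have "\<not> v t ^ j < v x" using not_less_Least[of j "\<lambda>k. v t ^ k < v x"] k_def by simp
  moreover have "\<not> v x < v t ^ j"
  proof
    assume "v x < v t ^ j"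
    then have "v (x / t ^ j) < 1" by (simp add: v_divide v_power t_pos)
    then have "v (x / t ^ j) \<le> v t" by (rule t_max)
    then show False using k j by (simp add: v_divide v_power t_pos field_simps)
  qed
  ultimately have "v x = v t ^ j" by simp
  then show ?thesis by (rule that)
qed

text \<open>An element of \<open>D\<close> with least exponent divides everything of smaller or
  equal value, so closure under multiplication by \<open>R\<close> already generates the whole ideal
  from it.\<close>

lemma ideal_is_P:
  assumes "D \<subseteq> R" "x \<in> D" "x \<noteq> 0" "\<And>c y. c \<in> R \<Longrightarrow> y \<in> D \<Longrightarrow> c * y \<in> D"
  obtains k where "D = P k"
proof -
  let ?Q = "\<lambda>k. \<exists>y\<in>D. v y = v t ^ k"
  define k where "k = (LEAST k. ?Q k)"
  have "\<exists>k. ?Q k" using assms value_is_power by (metis subsetD)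
  then have "?Q k" unfolding k_def by (rule LeastI_ex)
  then obtain y where y: "y \<in> D" "v y = v t ^ k" by blast
  have y0: "y \<noteq> 0" using y(2) by (metis power_not_zero t_nonzero v_eq_0)
  have "D = P k"
  proof (intro equalityI subsetI)
    fix z assume z: "z \<in> D"
    show "z \<in> P k"
    proof (cases "z = 0")
      case False
      then obtain j where j: "v z = v t ^ j" using value_is_power z assms by blast
      then have "k \<le> j" unfolding k_def using z by (intro Least_le) auto
      then show ?thesis using j t_power_P[of j k] by (simp add: P_def v_power)
    qed (simp add: P_def t_pos less_imp_le)
  next
    fix z assume "z \<in> P k"
    then have "z / y \<in> R" using y0 y by (simp add: P_def valuation_ring_def v_divide divide_le_eq_1 t_pos)
    then have "z / y * y \<in> D" using assms y by blast
    then show "z \<in> D" using y0 by simp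
  qed
  then show ?thesis by (rule that)
qed

section \<open>Representatives modulo powers of the uniformizer\<close>

lemma P_1_eq: "x \<in> P (Suc 0) \<longleftrightarrow> v x < 1"
  using t_max[of x] t_less_1 by (auto simp: P_def)

lemma ex_residue_transversal: "\<exists>S. transversal R (P (Suc 0)) S \<and> finite S \<and> card S = q"
proof -
  obtain S where S: "transversal R (P (Suc 0)) S" using ex_transversal[of "P (Suc 0)" R] by auto
  have "bij_betw (\<lambda>t. {(x, y). x \<in> R \<and> y \<in> R \<and> v (x - y) < 1} `` {t}) S
      (R // {(x, y). x \<in> R \<and> y \<in> R \<and> v (x - y) < 1})"
    using bij_betw_quotient_transversal[OF S] by (simp add: P_1_eq)
  then have "finite S" "card S = q"
    using finite_residue bij_betw_finite bij_betw_same_card unfolding residue_field_size_def by blast+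
  with S show ?thesis by blast
qed

text \<open>0 and 1 are incongruent modulo the maximal ideal. The bound is what makes powers of
  \<open>q\<close> cancellable and \<open>N \<mapsto> q ^ N\<close> injective later on.\<close>

lemma q_ge_2: "q \<ge> 2"
proof -
  obtain S where S: "transversal R (P (Suc 0)) S" "finite S" "card S = q"
    using ex_residue_transversal by blast
  obtain a where a: "a \<in> S" "0 - a \<in> P (Suc 0)" using transversalE[OF S(1)] R_0 by metis
  obtain b where b: "b \<in> S" "1 - b \<in> P (Suc 0)" using transversalE[OF S(1)] R_1 by metis
  have "a \<noteq> b"
  proof
    assume "a = b"
    then have "(1 - a) - (0 - a) \<in> P (Suc 0)" 
      using a b by (intro add_subgroup_diff[of "P (Suc 0)" "1 - a" "0 - a"] subgroup_P) simp_all
    then show False by (simp add: P_1_eq)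
  qed
  then have "card {a, b} = 2" by simp
  moreover have "card {a, b} \<le> card S" using a b S by (intro card_mono) auto
  ultimately show ?thesis using S by simp
qed

text \<open>One more digit of the \<open>t\<close>-adic expansion: if \<open>s\<close> runs through
  representatives modulo \<open>t ^ k\<close> and \<open>d\<close> through residue representatives,
  then \<open>s + t ^ k * d\<close> runs through representatives modulo
  \<open>t ^ Suc k\<close>.\<close>

lemma ex_transversal_P: "\<exists>S. transversal R (P k) S \<and> finite S \<and> card S = q ^ k"
proof (induction k)
  case 0
  have "transversal R (P 0) {0}"
    by (rule transversalI) (auto simp: R_eq_P[symmetric])
  then show ?case by (intro exI[of _ "{0}"]) simp
next
  case (Suc k)
  then obtain S where S: "transversal R (P k) S" "finite S" "card S = q ^ k" by blast
  obtain D where D: "transversal R (P (Suc 0)) D" "finite D" "card D = q"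
    using ex_residue_transversal by blast
  have SR: "S \<subseteq> R" and DR: "D \<subseteq> R" using S D by (auto simp: transversal_def)
  define f where "f = (\<lambda>(s, d). s + t ^ k * d)"
  have mult: "t ^ k * x \<in> P (Suc k) \<longleftrightarrow> x \<in> P (Suc 0)" for x
    by (simp add: P_def v_mult v_power t_pos)
  have key: "s = s' \<and> d = d'"
    if "s \<in> S" "s' \<in> S" "d \<in> D" "d' \<in> D" "f (s, d) - f (s', d') \<in> P (Suc k)" for s s' d d'
  proof -
    have "P (Suc k) \<subseteq> P k" by (rule P_mono) simp
    then have 1: "f (s, d) - f (s', d') \<in> P k" using that by blast
    have "d - d' \<in> R" using that DR by (intro R_diff) auto
    then have "t ^ k * (d - d') \<in> P k" unfolding P_eq_mult by blast
    then have "(f (s, d) - f (s', d')) - t ^ k * (d - d') \<in> P k"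
      by (rule add_subgroup_diff[OF subgroup_P 1])
    then have "s - s' \<in> P k" by (simp add: f_def algebra_simps)
    then have ss: "s = s'" using transversalD[OF S(1)] that by auto
    then have "t ^ k * (d - d') \<in> P (Suc k)" using that by (simp add: f_def algebra_simps)
    then have "d = d'" using mult transversalD[OF D(1)] that by auto
    with ss show ?thesis by blast
  qed
  have "transversal R (P (Suc k)) (f ` (S \<times> D))"
  proof (rule transversalI)
    show "f ` (S \<times> D) \<subseteq> R" using SR DR by (auto simp: f_def intro!: R_add R_mult)
  next
    fix a assume "a \<in> R"
    then obtain s where s: "s \<in> S" "a - s \<in> P k" using transversalE[OF S(1)] by blast
    then obtain r where r: "r \<in> R" "a - s = t ^ k * r" by (auto simp: P_eq_mult)
    then obtain d where d: "d \<in> D" "r - d \<in> P (Suc 0)" using transversalE[OF D(1)] by blast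
    have "a - f (s, d) = t ^ k * (r - d)" using r by (simp add: f_def algebra_simps)
    then have "a - f (s, d) \<in> P (Suc k)" using mult d by simp
    then show "\<exists>x\<in>f ` (S \<times> D). a - x \<in> P (Suc k)" using s d by blast
  qed (use key in auto)
  moreover have "inj_on f (S \<times> D)"
    using key by (intro inj_onI) (auto simp: P_def t_pos less_imp_le)
  then have "card (f ` (S \<times> D)) = q ^ Suc k" using S D by (simp add: card_image)
  ultimately show ?case using S D by blast
qed

definition digits :: "nat \<Rightarrow> 'k set"
  where "digits k = (SOME S. transversal R (P k) S \<and> finite S \<and> card S = q ^ k)"

lemma digits: "transversal R (P k) (digits k)" "finite (digits k)" "card (digits k) = q ^ k"
  using someI_ex[OF ex_transversal_P, of k] by (simp_all add: digits_def)

lemma digits_R: "digits k \<subseteq> R"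
  using digits(1)[of k] by (simp add: transversal_def)

end

section \<open>Submodules and the diagonals of their Hermite normal forms\<close>

context finite_residue_valuation
begin

definition scl :: "'k \<Rightarrow> (nat \<Rightarrow> 'k) \<Rightarrow> nat \<Rightarrow> 'k"
  where "scl c x = (\<lambda>i. c * x i)"

text \<open>Vectors are functions on all naturals that vanish from \<open>m\<close> on. The modules
  of all ranks thus live in one type and form a chain, and \<open>M \<inter> V m\<close> needs no
  conversion of dimensions.\<close>

definition V :: "nat \<Rightarrow> (nat \<Rightarrow> 'k) set"
  where "V m = {x. (\<forall>i. x i \<in> R) \<and> (\<forall>i\<ge>m. x i = 0)}"

definition submod :: "(nat \<Rightarrow> 'k) set \<Rightarrow> bool"
  where "submod M \<longleftrightarrow> 0 \<in> M \<and> (\<forall>x\<in>M. \<forall>y\<in>M. x + y \<in> M) \<and> (\<forall>c\<in>R. \<forall>x\<in>M. scl c x \<in> M)"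

text \<open>Vectors in \<open>V (Suc i)\<close> end at coordinate \<open>i\<close>. Their last
  entries form the ideal generated by the \<open>i\<close>-th diagonal entry of the Hermite normal
  form.\<close>

definition lead :: "(nat \<Rightarrow> 'k) set \<Rightarrow> nat \<Rightarrow> 'k set"
  where "lead M i = (\<lambda>x. x i) ` (M \<inter> V (Suc i))"

text \<open>The ideal \<open>lead M i\<close> of a submodule is zero or some \<open>P k\<close>;
  requiring the latter for every \<open>i < m\<close> excludes the zero ideal and expresses finite
  index without mentioning quotients.\<close>

definition full_rank :: "nat \<Rightarrow> (nat \<Rightarrow> 'k) set \<Rightarrow> bool"
  where "full_rank m M \<longleftrightarrow> submod M \<and> M \<subseteq> V m \<and> (\<forall>i<m. \<exists>k. lead M i = P k)"

text \<open>The exponents of the diagonal entries of the Hermite normal form of \<open>M\<close>.\<close>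

definition diag :: "(nat \<Rightarrow> 'k) set \<Rightarrow> nat \<Rightarrow> nat"
  where "diag M i = (SOME k. lead M i = P k)"

text \<open>Vectors whose entries are reduced modulo the diagonal exponents \<open>d\<close>: the
  remainders of division by a triangular system.\<close>

definition Box :: "nat \<Rightarrow> (nat \<Rightarrow> nat) \<Rightarrow> (nat \<Rightarrow> 'k) set"
  where "Box m d = {x. (\<forall>i<m. x i \<in> digits (d i)) \<and> (\<forall>i\<ge>m. x i = 0)}"

lemma submod_0: "submod M \<Longrightarrow> 0 \<in> M"
  and submod_add: "submod M \<Longrightarrow> x \<in> M \<Longrightarrow> y \<in> M \<Longrightarrow> x + y \<in> M"
  and submod_scl: "submod M \<Longrightarrow> c \<in> R \<Longrightarrow> x \<in> M \<Longrightarrow> scl c x \<in> M"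
  by (auto simp: submod_def)

lemma submod_uminus: "submod M \<Longrightarrow> x \<in> M \<Longrightarrow> - x \<in> M"
  using submod_scl[of M "- 1" x] R_uminus[of 1] by (simp add: scl_def fun_Compl_def)

lemma submod_diff: "submod M \<Longrightarrow> x \<in> M \<Longrightarrow> y \<in> M \<Longrightarrow> x - y \<in> M"
  using submod_add[of M x "- y"] submod_uminus[of M y] by simp

lemma submod_subgroup: "submod M \<Longrightarrow> add_subgroup M"
  by (auto simp: add_subgroup_def submod_0 submod_diff)

lemma submod_V [simp]: "submod (V m)"
  by (auto simp: submod_def V_def scl_def intro!: R_add R_mult)

lemma submod_Int: "submod M \<Longrightarrow> submod M' \<Longrightarrow> submod (M \<inter> M')"
  by (auto simp: submod_def)

lemma V_mono: "m \<le> n \<Longrightarrow> V m \<subseteq> V n"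
  by (auto simp: V_def)

lemma lead_Int: "i < m \<Longrightarrow> lead (M \<inter> V m) i = lead M i"
  using V_mono[of "Suc i" m] by (auto simp: lead_def)

lemma diag_Int: "i < m \<Longrightarrow> diag (M \<inter> V m) i = diag M i"
  by (simp add: diag_def lead_Int)

lemma full_rank_submod: "full_rank m M \<Longrightarrow> submod M"
  and full_rank_subset: "full_rank m M \<Longrightarrow> M \<subseteq> V m"
  by (auto simp: full_rank_def)

lemma lead_eq_P: "full_rank m M \<Longrightarrow> i < m \<Longrightarrow> lead M i = P (diag M i)"
  unfolding full_rank_def diag_def by (metis (mono_tags, lifting) someI_ex)

lemma diag_eqI: "lead M i = P k \<Longrightarrow> diag M i = k"
  unfolding diag_def using P_inj by (metis (mono_tags, lifting) someI)

lemma full_rank_Int: "full_rank n M \<Longrightarrow> m \<le> n \<Longrightarrow> full_rank m (M \<inter> V m)"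
  by (auto simp: full_rank_def lead_Int intro: submod_Int)

lemma lead_obtain:
  assumes "full_rank m M" "i < m" "a \<in> P (diag M i)"
  obtains x where "x \<in> M" "x \<in> V (Suc i)" "x i = a"
proof -
  have "a \<in> lead M i" using lead_eq_P[OF assms(1,2)] assms(3) by simp
  then show ?thesis using that by (auto simp: lead_def)
qed

lemma lead_memI:
  assumes "full_rank m M" "i < m" "x \<in> M" "x \<in> V (Suc i)"
  shows "x i \<in> P (diag M i)"
  unfolding lead_eq_P[OF assms(1,2), symmetric] lead_def using assms(3,4) by simp

lemma V_Suc_restrict: "x \<in> V (Suc m) \<Longrightarrow> x m = 0 \<Longrightarrow> x \<in> V m"
  by (auto simp: V_def) (metis Suc_leI le_neq_implies_less)

lemma V_upd_0: "x \<in> V (Suc m) \<Longrightarrow> x(m := 0) \<in> V m"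
  by (auto simp: V_def) 

lemma V_upd: "x \<in> V m \<Longrightarrow> a \<in> R \<Longrightarrow> x(m := a) \<in> V (Suc m)"
  by (auto simp: V_def) 

lemma Box_subset_V: "Box m d \<subseteq> V m"
proof
  fix x assume x: "x \<in> Box m d"
  have "x i \<in> R" for i
    using x digits_R[of "d i"] by (cases "i < m") (auto simp: Box_def)
  then show "x \<in> V m" using x by (simp add: Box_def V_def)
qed

lemma Box_cong: "(\<And>i. i < m \<Longrightarrow> d i = d' i) \<Longrightarrow> Box m d = Box m d'"
  by (simp add: Box_def)

lemma finite_card_Box: "finite (Box m d) \<and> card (Box m d) = q ^ (\<Sum>i<m. d i)"
proof (induction m)
  case 0
  have "Box 0 d = {\<lambda>_. 0}" by (auto simp: Box_def)
  then show ?case by simp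
next
  case (Suc m)
  have "bij_betw (\<lambda>(x, a). x(m := a)) (Box m d \<times> digits (d m)) (Box (Suc m) d)"
  proof (rule bij_betwI[where g = "\<lambda>x. (x(m := 0), x m)"])
    show "(\<lambda>(x, a). x(m := a)) \<in> Box m d \<times> digits (d m) \<rightarrow> Box (Suc m) d"
      by (auto simp: Box_def less_Suc_eq)
    show "(\<lambda>x. (x(m := 0), x m)) \<in> Box (Suc m) d \<rightarrow> Box m d \<times> digits (d m)"
      by (auto simp: Box_def)
  qed (auto simp: Box_def fun_eq_iff)
  then show ?case
    using Suc digits[of "d m"] bij_betw_finite bij_betw_same_card
    by (fastforce simp: card_cartesian_product power_add)
qed

text \<open>Division with remainder by the Hermite normal form, from the last coordinate downwards.
  An element of \<open>M\<close> with suitable last entry reduces coordinate \<open>m\<close> to a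
  digit, and the rest is reduced inside \<open>V m\<close>. For uniqueness, a difference of two
  remainders in \<open>M\<close> has its last entry in \<open>lead M m\<close>, so the last digits
  agree and the difference drops to \<open>V m\<close>.\<close>

lemma transversal_Box:
  assumes "full_rank m M"
  shows "transversal (V m) M (Box m (diag M))"
  using assms
proof (induction m arbitrary: M)
  case 0
  then have "M = {0}" using full_rank_subset submod_0[OF full_rank_submod] by (fastforce simp: V_def)
  moreover have "V 0 = {0}" "Box 0 (diag M) = {0}" by (auto simp: V_def Box_def fun_eq_iff)
  ultimately show ?case by (simp add: transversal_def)
next
  case (Suc m)
  note M = full_rank_submod[OF Suc.prems]
  have BM: "Box m (diag (M \<inter> V m)) = Box m (diag M)" by (intro Box_cong) (simp add: diag_Int)
  have IH: "transversal (V m) (M \<inter> V m) (Box m (diag M))"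
    using Suc.IH[OF full_rank_Int[OF Suc.prems]] BM by simp
  show ?case
  proof (rule transversalI[OF Box_subset_V _ _ submod_subgroup[OF M]])
    fix a assume a: "a \<in> V (Suc m)"
    then have "a m \<in> R" by (simp add: V_def)
    then obtain s where s: "s \<in> digits (diag M m)" "a m - s \<in> P (diag M m)"
      using transversalE[OF digits(1)] by blast
    obtain g where g: "g \<in> M" "g \<in> V (Suc m)" "g m = a m - s"
      using lead_obtain[OF Suc.prems _ s(2)] by blast
    define a' where "a' = (a - g)(m := 0)"
    have "a' \<in> V m" unfolding a'_def using a g by (intro V_upd_0 submod_diff) auto
    then obtain b where b: "b \<in> Box m (diag M)" "a' - b \<in> M \<inter> V m" using transversalE[OF IH] by blast
    have "b(m := s) \<in> Box (Suc m) (diag M)" using b s by (auto simp: Box_def less_Suc_eq)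
    moreover have "a - b(m := s) = (a' - b) + g"
      using g(3) b(1) by (auto simp: a'_def fun_eq_iff Box_def)
    then have "a - b(m := s) \<in> M" using submod_add[OF M] b g by simp
    ultimately show "\<exists>b\<in>Box (Suc m) (diag M). a - b \<in> M" by blast
  next
    fix x y assume x: "x \<in> Box (Suc m) (diag M)" and y: "y \<in> Box (Suc m) (diag M)" and xy: "x - y \<in> M"
    have "x - y \<in> V (Suc m)" using xy full_rank_subset[OF Suc.prems] by blast
    then have "x m - y m \<in> P (diag M m)" using lead_memI[OF Suc.prems _ xy] by simp
    then have m: "x m = y m"
      using x y transversalD[OF digits(1) _ _ _ subgroup_P] by (auto simp: Box_def)
    have x': "x(m := 0) \<in> Box m (diag M)" and y': "y(m := 0) \<in> Box m (diag M)"
      using x y by (auto simp: Box_def)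
    have "x(m := 0) - y(m := 0) = x - y" using m by (auto simp: fun_eq_iff)
    moreover have "x - y \<in> V m" using V_Suc_restrict[OF \<open>x - y \<in> V (Suc m)\<close>] m by simp
    ultimately have "x(m := 0) = y(m := 0)"
      using transversalD[OF IH x' y'] xy submod_subgroup[OF submod_Int[OF M submod_V]] by simp
    then show "x = y" using m by (metis fun_upd_triv fun_upd_upd)
  qed
qed

end

section \<open>Submodules invariant under a shift of the basis\<close>

text \<open>\<open>h\<close> is total on the naturals: for a vector in \<open>V m\<close>, an index
  \<open>j\<close> with \<open>m \<le> h j\<close> simply receives the value 0. Nilpotency on each
  \<open>V m\<close> comes from \<open>h_gt\<close>.\<close>

locale nilpotent_shift = finite_residue_valuation +
  fixes h :: "nat \<Rightarrow> nat"
  assumes h_mono: "strict_mono h" and h_gt: "j < h j"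
begin

text \<open>The shift \<open>x \<mapsto> x \<circ> h\<close> sends the basis vector \<open>e\<^bsub>h j\<^esub>\<close> to \<open>e\<^bsub>j\<^esub>\<close> and the other ones to \<open>0\<close>;
  it maps \<open>V m\<close> onto \<open>V (c m)\<close>.\<close>

definition c :: "nat \<Rightarrow> nat"
  where "c m = (LEAST j. m \<le> h j)"

lemma less_c_iff: "j < c m \<longleftrightarrow> h j < m"
proof -
  have "m \<le> h (c m)" unfolding c_def by (rule LeastI[of _ m]) (use h_gt[of m] in simp)
  then have "h j < m" if "j < c m" using not_less_Least that unfolding c_def by fastforce
  moreover have "j < c m" if "h j < m"
    using \<open>m \<le> h (c m)\<close> that strict_mono_less[OF h_mono] by (metis order.strict_trans2)
  ultimately show ?thesis by blast
qed

lemma c_le: "c m \<le> m"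
  using less_c_iff[of m m] h_gt[of m] by simp

lemma c_h: "c (h j) = j"
  using less_c_iff[of _ "h j"] strict_mono_less[OF h_mono] by (metis nat_neq_iff)

section \<open>Invariant submodules and their extensions by one basis vector\<close>

definition Lat :: "nat \<Rightarrow> (nat \<Rightarrow> 'a) set set"
  where "Lat m = {M. full_rank m M \<and> (\<forall>x\<in>M. x \<circ> h \<in> M)}"

text \<open>Candidates for the last row of a Hermite normal form with diagonal entry
  \<open>t ^ k\<close>, reduced modulo the earlier rows. Invariance of the extension has to be
  tested on this row only, and its shift must lie in \<open>M\<close> because the shift maps
  \<open>V (Suc m)\<close> into \<open>V m\<close>.\<close>

definition tails :: "nat \<Rightarrow> (nat \<Rightarrow> 'a) set \<Rightarrow> nat \<Rightarrow> (nat \<Rightarrow> 'a) set"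
  where "tails m M k = {b \<in> Box m (diag M). b(m := t ^ k) \<circ> h \<in> M}"

definition ext :: "nat \<Rightarrow> (nat \<Rightarrow> 'a) set \<Rightarrow> nat \<Rightarrow> (nat \<Rightarrow> 'a) \<Rightarrow> (nat \<Rightarrow> 'a) set"
  where "ext m M k b = {x + scl r (b(m := t ^ k)) | x r. x \<in> M \<and> r \<in> R}"

lemma shift_V: "(\<lambda>x. x \<circ> h) ` V m = V (c m)"
proof (intro equalityI subsetI)
  fix y assume "y \<in> (\<lambda>x. x \<circ> h) ` V m"
  then show "y \<in> V (c m)" using less_c_iff[of _ m] by (auto simp: V_def not_less[symmetric])
next
  fix y assume y: "y \<in> V (c m)"
  \<comment> \<open>\<open>c\<close> is a left inverse of \<open>h\<close>, so this is the preimage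
    that is 0 off the range of \<open>h\<close>.\<close>
  define x where "x i = (if i \<in> range h then y (c i) else 0)" for i
  have "x i = 0" if "i \<ge> m" for i
    using that y less_c_iff[of "c i" m] by (auto simp: x_def V_def c_h not_less[symmetric])
  then have "x \<in> V m" using y by (auto simp: V_def x_def)
  moreover have "x \<circ> h = y" by (auto simp: x_def c_h)
  ultimately show "y \<in> (\<lambda>x. x \<circ> h) ` V m" by blast
qed

lemma shift_V_Suc: "x \<in> V (Suc m) \<Longrightarrow> x \<circ> h \<in> V m"
proof -
  assume x: "x \<in> V (Suc m)"
  have "x (h i) = 0" if "i \<ge> m" for i using that x h_gt[of i] by (simp add: V_def)
  then show ?thesis using x by (auto simp: V_def)
qed

lemma shift_add: "(x + y) \<circ> h = (x \<circ> h) + (y \<circ> h)" for x y :: "nat \<Rightarrow> 'a"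
  by (auto simp: fun_eq_iff)

lemma shift_scl: "scl r x \<circ> h = scl r (x \<circ> h)"
  by (auto simp: scl_def)

lemma scl_0: "scl 0 x = 0" and scl_1: "scl 1 x = x"
  and scl_add: "scl a (x + y) = scl a x + scl a y"
  and add_scl: "scl (a + b) x = scl a x + scl b x"
  and scl_scl: "scl a (scl b x) = scl (a * b) x"
  by (auto simp: scl_def fun_eq_iff algebra_simps)

text \<open>Coordinate \<open>m\<close> of \<open>x + scl r g\<close> is \<open>t ^ k * r\<close>.
  This gives the last leading ideal, and it shows that only \<open>r = 0\<close> stays in
  \<open>V m\<close>, so intersecting with \<open>V m\<close> returns \<open>M\<close>.\<close>

lemma ext_props:
  assumes M: "M \<in> Lat m" and b: "b \<in> tails m M k"
  shows "ext m M k b \<in> Lat (Suc m)" "ext m M k b \<inter> V m = M" "lead (ext m M k b) m = P k"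
    "b(m := t ^ k) \<in> ext m M k b"
proof -
  define g where "g = b(m := t ^ k)"
  have rank: "full_rank m M" and MM: "submod M" and MV: "M \<subseteq> V m" and inv: "\<And>x. x \<in> M \<Longrightarrow> x \<circ> h \<in> M"
    using M full_rank_submod full_rank_subset by (auto simp: Lat_def)
  have bB: "b \<in> Box m (diag M)" and gh: "g \<circ> h \<in> M" using b by (auto simp: tails_def g_def)
  have gV: "g \<in> V (Suc m)" unfolding g_def using bB Box_subset_V by (intro V_upd) auto
  have gm: "g m = t ^ k" by (simp add: g_def)
  let ?E = "ext m M k b"
  have E: "?E = {x + scl r g | x r. x \<in> M \<and> r \<in> R}" by (simp add: ext_def g_def)
  have ME: "x \<in> ?E" if "x \<in> M" for x
    unfolding E using that scl_0[of g] by (metis (mono_tags, lifting) R_0 add.right_neutral mem_Collect_eq)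
  have gE: "g \<in> ?E"
    unfolding E using submod_0[OF MM] scl_1[of g] by (metis (mono_tags, lifting) R_1 add_0 mem_Collect_eq)
  then show "b(m := t ^ k) \<in> ?E" by (simp add: g_def)
  have val: "(x + scl r g) m = t ^ k * r" if "x \<in> M" for x r
    using that MV gm by (auto simp: V_def scl_def)
  have EV: "?E \<subseteq> V (Suc m)"
  proof
    fix y assume "y \<in> ?E"
    then obtain x r where "y = x + scl r g" "x \<in> M" "r \<in> R" unfolding E by blast
    then show "y \<in> V (Suc m)"
      using MV V_mono[of m "Suc m"] gV by (auto intro!: submod_add submod_scl)
  qed
  have sub: "submod ?E"
    unfolding submod_def
  proof (intro conjI ballI)
    show "0 \<in> ?E" using ME submod_0[OF MM] by blast
  next
    fix y y' assume "y \<in> ?E" "y' \<in> ?E"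
    then obtain x r x' r' where "y = x + scl r g" "x \<in> M" "r \<in> R" "y' = x' + scl r' g" "x' \<in> M" "r' \<in> R"
      unfolding E by blast
    then have "y + y' = (x + x') + scl (r + r') g" "x + x' \<in> M" "r + r' \<in> R"
      by (auto simp: add_scl algebra_simps intro: submod_add[OF MM] R_add)
    then show "y + y' \<in> ?E" unfolding E by blast
  next
    fix a y assume a: "a \<in> R" and "y \<in> ?E"
    then obtain x r where "y = x + scl r g" "x \<in> M" "r \<in> R" unfolding E by blast
    then have "scl a y = scl a x + scl (a * r) g" "scl a x \<in> M" "a * r \<in> R"
      using a by (auto simp: scl_add scl_scl intro: submod_scl[OF MM] R_mult)
    then show "scl a y \<in> ?E" unfolding E by blast
  qed
  show Int: "?E \<inter> V m = M"
  proof (intro equalityI subsetI)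
    fix y assume y: "y \<in> ?E \<inter> V m"
    then obtain x r where xr: "y = x + scl r g" "x \<in> M" "r \<in> R" unfolding E by blast
    have "y m = 0" using y by (simp add: V_def)
    then have "r = 0" using val[OF xr(2), of r] xr(1) by simp
    then show "y \<in> M" using xr scl_0 by simp
  qed (use ME MV in blast)
  have "lead ?E m = (\<lambda>x. x m) ` ?E" using EV by (simp add: lead_def Int_absorb2)
  also have "\<dots> = P k"
  proof (intro equalityI subsetI)
    fix a assume "a \<in> (\<lambda>x. x m) ` ?E"
    then obtain x r where "a = (x + scl r g) m" "x \<in> M" "r \<in> R" unfolding E by blast
    then show "a \<in> P k" using val P_eq_mult by blast
  next
    fix a assume "a \<in> P k"
    then obtain r where r: "r \<in> R" "a = t ^ k * r" unfolding P_eq_mult by blast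
    then have "0 + scl r g \<in> ?E" using submod_0[OF MM] unfolding E by blast
    moreover have "a = (0 + scl r g) m" using val[OF submod_0[OF MM], of r] r by (simp only:)
    ultimately show "a \<in> (\<lambda>x. x m) ` ?E" unfolding image_iff by blast
  qed
  finally show lead: "lead ?E m = P k" .
  have "\<exists>j. lead ?E i = P j" if "i < Suc m" for i
  proof (cases "i = m")
    case False
    then have "i < m" using that by simp
    then have "lead ?E i = lead M i" using lead_Int[of i m ?E] Int by simp
    then show ?thesis using lead_eq_P[OF rank \<open>i < m\<close>] by metis
  qed (use lead in blast)
  then have "full_rank (Suc m) ?E" using sub EV by (simp add: full_rank_def)
  moreover have "y \<circ> h \<in> ?E" if y: "y \<in> ?E" for y
  proof -
    obtain x r where xr: "y = x + scl r g" "x \<in> M" "r \<in> R" using y unfolding E by blast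
    then have "y \<circ> h = (x \<circ> h) + scl r (g \<circ> h)" by (simp add: shift_add shift_scl)
    then have "y \<circ> h \<in> M" using inv xr gh MM by (simp add: submod_add submod_scl)
    then show ?thesis by (rule ME)
  qed
  ultimately show "?E \<in> Lat (Suc m)" by (simp add: Lat_def)
qed

text \<open>Choose an element with last entry exactly \<open>t ^ k\<close>, where \<open>k\<close>
  is the last diagonal exponent, and reduce its other coordinates modulo
  \<open>M' \<inter> V m\<close>. The result generates \<open>M'\<close> over that intersection,
  since the last entry of any element is a multiple of \<open>t ^ k\<close>.\<close>

lemma ext_surj:
  assumes "M' \<in> Lat (Suc m)"
  obtains b where "M' \<inter> V m \<in> Lat m" "b \<in> tails m (M' \<inter> V m) (diag M' m)"
    "M' = ext m (M' \<inter> V m) (diag M' m) b"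
proof -
  have rank: "full_rank (Suc m) M'" and inv: "\<And>x. x \<in> M' \<Longrightarrow> x \<circ> h \<in> M'"
    using assms by (auto simp: Lat_def)
  note M' = full_rank_submod[OF rank] and M'V = full_rank_subset[OF rank]
  let ?M = "M' \<inter> V m" and ?k = "diag M' m"
  have rank': "full_rank m ?M" using full_rank_Int[OF rank] by simp
  have invV: "x \<circ> h \<in> ?M" if "x \<in> M'" for x using that inv M'V shift_V_Suc by blast
  then have 1: "?M \<in> Lat m" using rank' by (simp add: Lat_def)
  obtain g0 where g0: "g0 \<in> M'" "g0 \<in> V (Suc m)" "g0 m = t ^ ?k"
    using lead_obtain[OF rank, of m "t ^ ?k"] by (auto simp: t_power_P)
  obtain b where b: "b \<in> Box m (diag ?M)" "g0(m := 0) - b \<in> ?M"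
    using transversalE[OF transversal_Box[OF rank'] V_upd_0[OF g0(2)]] by blast
  let ?g = "b(m := t ^ ?k)"
  have "?g = g0 - (g0(m := 0) - b)" using g0 b(1) by (auto simp: fun_eq_iff Box_def)
  then have gM: "?g \<in> M'" using submod_diff[OF M' g0(1)] b(2) by simp
  then have 2: "b \<in> tails m ?M ?k" using invV b by (simp add: tails_def)
  have "M' = ext m ?M ?k b"
  proof (intro equalityI subsetI)
    fix y assume y: "y \<in> M'"
    then have "y m \<in> P ?k" using lead_memI[OF rank] M'V by blast
    then obtain r where r: "r \<in> R" "y m = t ^ ?k * r" by (auto simp: P_eq_mult)
    have "y - scl r ?g \<in> M'" using y gM r by (intro submod_diff submod_scl M')
    moreover have "(y - scl r ?g) m = 0" using r by (simp add: scl_def)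
    ultimately have "y - scl r ?g \<in> ?M" using V_Suc_restrict M'V by blast
    moreover have "y = (y - scl r ?g) + scl r ?g" by simp
    ultimately show "y \<in> ext m ?M ?k b" using r unfolding ext_def by blast
  next
    fix y assume "y \<in> ext m ?M ?k b"
    then show "y \<in> M'" using gM by (auto simp: ext_def intro!: submod_add[OF M'] submod_scl[OF M'])
  qed
  then show ?thesis by (rule that[OF 1 2])
qed

text \<open>All three data can be recovered from the extension: \<open>M\<close> as its intersection
  with \<open>V m\<close>, \<open>k\<close> from its last leading ideal, and \<open>b\<close>
  because two tails with the same extension differ by an element of \<open>M\<close> and are both
  reduced.\<close>

lemma bij_betw_ext:
  "bij_betw (\<lambda>(M, k, b). ext m M k b) (SIGMA M:Lat m. SIGMA k:UNIV. tails m M k) (Lat (Suc m))"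
  unfolding bij_betw_def
proof
  show "inj_on (\<lambda>(M, k, b). ext m M k b) (SIGMA M:Lat m. SIGMA k:UNIV. tails m M k)"
  proof (rule inj_onI)
    fix z z'
    assume "z \<in> (SIGMA M:Lat m. SIGMA k:UNIV. tails m M k)" "z' \<in> (SIGMA M:Lat m. SIGMA k:UNIV. tails m M k)"
      and "(\<lambda>(M, k, b). ext m M k b) z = (\<lambda>(M, k, b). ext m M k b) z'"
    then obtain M k b M' k' b' where z: "z = (M, k, b)" "z' = (M', k', b')"
      and M: "M \<in> Lat m" and b: "b \<in> tails m M k" and M': "M' \<in> Lat m" and b': "b' \<in> tails m M' k'"
      and eq: "ext m M k b = ext m M' k' b'" by fastforce
    note p = ext_props[OF M b] and p' = ext_props[OF M' b']
    have MM: "M = M'" using p(2) p'(2) eq by simp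
    have kk: "k = k'" using p(3) p'(3) eq P_inj by simp
    have rank: "full_rank m M" using M by (simp add: Lat_def)
    let ?E = "ext m M k b"
    have sE: "submod ?E" using p(1) full_rank_submod by (auto simp: Lat_def)
    have B: "b \<in> Box m (diag M)" "b' \<in> Box m (diag M)" using b b' MM by (auto simp: tails_def)
    have "b(m := t ^ k) - b'(m := t ^ k) \<in> ?E"
      using p(4) p'(4) eq kk by (intro submod_diff[OF sE]) auto
    moreover have "b(m := t ^ k) - b'(m := t ^ k) = b - b'" using B by (auto simp: fun_eq_iff Box_def)
    moreover have "b - b' \<in> V m" using B Box_subset_V by (intro submod_diff) auto
    ultimately have "b - b' \<in> M" using p(2) by auto
    then have "b = b'"
      using transversalD[OF transversal_Box[OF rank] B] submod_subgroup[OF full_rank_submod[OF rank]] by blast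
    then show "z = z'" using MM kk z by simp
  qed
  show "(\<lambda>(M, k, b). ext m M k b) ` (SIGMA M:Lat m. SIGMA k:UNIV. tails m M k) = Lat (Suc m)"
  proof (intro equalityI subsetI)
    fix M' assume "M' \<in> Lat (Suc m)"
    then obtain b where "M' \<inter> V m \<in> Lat m" "b \<in> tails m (M' \<inter> V m) (diag M' m)"
      "M' = ext m (M' \<inter> V m) (diag M' m) b" by (rule ext_surj)
    then show "M' \<in> (\<lambda>(M, k, b). ext m M k b) ` (SIGMA M:Lat m. SIGMA k:UNIV. tails m M k)"
      by (intro image_eqI[of _ _ "(M' \<inter> V m, diag M' m, b)"]) auto
  next
    fix M' assume "M' \<in> (\<lambda>(M, k, b). ext m M k b) ` (SIGMA M:Lat m. SIGMA k:UNIV. tails m M k)"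
    then obtain M k b where "M \<in> Lat m" "b \<in> tails m M k" "M' = ext m M k b" by fastforce
    then show "M' \<in> Lat (Suc m)" using ext_props(1) by simp
  qed
qed

lemma diag_ext:
  assumes "M \<in> Lat m" "b \<in> tails m M k"
  shows "diag (ext m M k b) m = k" "i < m \<Longrightarrow> diag (ext m M k b) i = diag M i"
  using diag_eqI ext_props[OF assms] diag_Int[of i m "ext m M k b"] by auto

lemma finite_tails: "finite (tails m M k)"
  using finite_card_Box[of m "diag M"] by (simp add: tails_def)

text \<open>This is \<open>card_transversal_fibre\<close> for the shift on \<open>V m\<close> modulo
  \<open>M\<close>, with image \<open>V (c m)\<close>. The number of solutions is the quotient of
  the sizes of \<open>V m / M\<close> and \<open>V (c m) / (M \<inter> V (c m))\<close>, both powers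
  of \<open>q\<close> by \<open>transversal_Box\<close>. If \<open>h\<close> hits \<open>m\<close>,
  the right-hand side is a multiple of the basis vector at \<open>c m\<close>; the equation is
  solvable exactly if \<open>t ^ k\<close> belongs to the leading ideal of \<open>M\<close>
  there.\<close>

lemma card_tails:
  assumes "M \<in> Lat m"
  shows "card (tails m M k) =
    (if m \<in> range h \<and> k < diag M (c m) then 0 else q ^ (\<Sum>i\<in>{c m..<m}. diag M i))"
proof -
  have rank: "full_rank m M" and inv: "\<And>x. x \<in> M \<Longrightarrow> x \<circ> h \<in> M" using assms by (auto simp: Lat_def)
  note sM = full_rank_submod[OF rank] and MV = full_rank_subset[OF rank]
  \<comment> \<open>The negative of the shift of \<open>t ^ k\<close> times the basis vector at
    \<open>m\<close>: that shift sits at the unique \<open>i\<close> with \<open>h i = m\<close>,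
    which is \<open>c m\<close>, and is 0 if there is no such \<open>i\<close>.\<close>
  define f :: "nat \<Rightarrow> 'a" where "f = (\<lambda>i. if m \<in> range h \<and> i = c m then - (t ^ k) else 0)"
  have c_less: "c m < m" if "m \<in> range h" using that h_gt c_h by auto
  have fV: "f \<in> V m" using c_less R_uminus by (auto simp: V_def f_def)
  have eq: "tails m M k = {b \<in> Box m (diag M). (b \<circ> h) - f \<in> M}"
  proof -
    have "b(m := t ^ k) \<circ> h = (b \<circ> h) - f" if b: "b \<in> Box m (diag M)" for b
    proof
      fix i
      have "m \<in> range h \<and> i = c m \<longleftrightarrow> h i = m" using c_h by force
      then show "(b(m := t ^ k) \<circ> h) i = ((b \<circ> h) - f) i"
        using b by (simp add: f_def Box_def)
    qed
    then show ?thesis by (auto simp: tails_def)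
  qed
  have rank': "full_rank (c m) (M \<inter> V (c m))" by (rule full_rank_Int[OF rank c_le])
  have "Box (c m) (diag (M \<inter> V (c m))) = Box (c m) (diag M)" by (intro Box_cong) (simp add: diag_Int)
  then have U: "transversal (V (c m)) (M \<inter> V (c m)) (Box (c m) (diag M))"
    using transversal_Box[OF rank'] by simp
  have fin: "finite (Box m (diag M))" using finite_card_Box by blast
  \<comment> \<open>Modulo \<open>V (c m)\<close> only the entry of \<open>f\<close> at
    \<open>c m\<close> survives, so solvability asks for an element of \<open>M\<close> ending in
    \<open>- (t ^ k)\<close> at that coordinate.\<close>
  have cond: "(\<exists>z\<in>V (c m). f - z \<in> M) \<longleftrightarrow> \<not> (m \<in> range h \<and> k < diag M (c m))"
  proof (cases "m \<in> range h")
    case False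
    then have "f - 0 \<in> M" using submod_0[OF sM] by (simp add: f_def zero_fun_def)
    then show ?thesis using False submod_0[OF submod_V, of "c m"] by blast
  next
    case True
    have fc: "f \<in> V (Suc (c m))" using R_uminus by (auto simp: V_def f_def)
    have fcm: "f (c m) = - (t ^ k)" using True by (simp add: f_def)
    have Pk: "- (t ^ k) \<in> P (diag M (c m)) \<longleftrightarrow> diag M (c m) \<le> k"
      using t_power_P[of k "diag M (c m)"] by (simp add: P_def)
    show ?thesis
    proof
      assume "\<exists>z\<in>V (c m). f - z \<in> M"
      then obtain z where z: "z \<in> V (c m)" "f - z \<in> M" by blast
      have "f - z \<in> V (Suc (c m))" using fc z V_mono[of "c m" "Suc (c m)"] by (intro submod_diff) auto
      then have "(f - z) (c m) \<in> P (diag M (c m))" using lead_memI[OF rank c_less[OF True] z(2)] by blast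
      moreover have "(f - z) (c m) = - (t ^ k)" using z fcm by (simp add: V_def)
      ultimately show "\<not> (m \<in> range h \<and> k < diag M (c m))" using Pk by simp
    next
      assume "\<not> (m \<in> range h \<and> k < diag M (c m))"
      then have "- (t ^ k) \<in> P (diag M (c m))" using Pk True by simp
      then obtain y where y: "y \<in> M" "y \<in> V (Suc (c m))" "y (c m) = - (t ^ k)"
        using lead_obtain[OF rank c_less[OF True]] by blast
      have "f - y \<in> V (c m)" 
        using V_Suc_restrict[OF submod_diff[OF submod_V fc y(2)]] fcm y(3) by simp
      moreover have "f - (f - y) \<in> M" using y by simp
      ultimately show "\<exists>z\<in>V (c m). f - z \<in> M" by blast
    qed
  qed
  have "card (tails m M k) * card (Box (c m) (diag M)) =
      (if \<exists>z\<in>V (c m). f - z \<in> M then card (Box m (diag M)) else 0)"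
    unfolding eq
  proof (rule card_transversal_fibre[where A = "V m" and N = "\<lambda>x. x \<circ> h", OF _ _ _ transversal_Box[OF rank] U])
    show "add_subgroup (V m)" "add_subgroup (V (c m))" "add_subgroup M"
      using submod_subgroup sM by auto
    show "(\<lambda>x. x \<circ> h) ` M \<subseteq> M" using inv by blast
  qed (use shift_V MV V_mono[OF c_le] fin fV in \<open>auto simp: fun_eq_iff\<close>)
  then have *: "card (tails m M k) * q ^ (\<Sum>i<c m. diag M i) =
      (if m \<in> range h \<and> k < diag M (c m) then 0 else q ^ (\<Sum>i<m. diag M i))"
    using finite_card_Box cond by simp
  have "(\<Sum>i<m. diag M i) = (\<Sum>i\<in>{c m..<m}. diag M i) + (\<Sum>i<c m. diag M i)"
    using sum.atLeastLessThan_concat[of 0 "c m" m "diag M"] c_le by (simp add: lessThan_atLeast0)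
  then show ?thesis using * q_ge_2 by (auto simp: power_add split: if_splits)
qed

end

section \<open>The generating function\<close>

text \<open>Indicator functions turn the dependent sum into a sum over a full product type, where
  Tonelli applies.\<close>

lemma nn_integral_count_space_Sigma:
  fixes f :: "'a \<Rightarrow> 'b \<Rightarrow> ennreal"
  shows "(\<integral>\<^sup>+z. f (fst z) (snd z) \<partial>count_space (Sigma A B)) =
    (\<integral>\<^sup>+x. (\<integral>\<^sup>+y. f x y \<partial>count_space (B x)) \<partial>count_space A)"
proof -
  have "(\<integral>\<^sup>+z. f (fst z) (snd z) \<partial>count_space (Sigma A B)) =
      (\<integral>\<^sup>+z. f (fst z) (snd z) * indicator (Sigma A B) z \<partial>count_space UNIV)"
    by (rule nn_integral_count_space_indicator) simp
  also have "\<dots> = (\<integral>\<^sup>+x. (\<integral>\<^sup>+y. f x y * indicator (Sigma A B) (x, y) \<partial>count_space UNIV) \<partial>count_space UNIV)"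
    by (subst nn_integral_fst_count_space[symmetric]) simp
  also have "\<dots> = (\<integral>\<^sup>+x. (\<integral>\<^sup>+y. f x y \<partial>count_space (B x)) * indicator A x \<partial>count_space UNIV)"
    by (intro nn_integral_cong)
      (auto simp: nn_integral_count_space_indicator indicator_def intro!: nn_integral_cong)
  also have "\<dots> = (\<integral>\<^sup>+x. (\<integral>\<^sup>+y. f x y \<partial>count_space (B x)) \<partial>count_space A)"
    by (rule nn_integral_count_space_indicator[symmetric]) simp
  finally show ?thesis .
qed

context nilpotent_shift
begin

definition weight_sum :: "nat \<Rightarrow> (nat \<Rightarrow> ennreal) \<Rightarrow> ennreal"
  where "weight_sum m w = (\<integral>\<^sup>+M. (\<Prod>i<m. w i ^ diag M i) \<partial>count_space (Lat m))"

lemma weight_sum_cong: "(\<And>i. i < m \<Longrightarrow> w i = w' i) \<Longrightarrow> weight_sum m w = weight_sum m w'"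
  by (simp add: weight_sum_def)

lemma weight_sum_0: "weight_sum 0 w = 1"
proof -
  have "Lat 0 = {{0}}"
  proof (intro equalityI subsetI)
    fix M assume M: "M \<in> Lat 0"
    then have "submod M" and V: "M \<subseteq> V 0" by (auto simp: Lat_def full_rank_def)
    then have "0 \<in> M" by (intro submod_0)
    moreover have "V 0 = {0}" by (auto simp: V_def fun_eq_iff)
    ultimately have "M = {0}" using V by (simp add: subset_singleton_iff) auto
    then show "M \<in> {{0}}" by simp
  next
    fix M :: "(nat \<Rightarrow> 'a) set" assume "M \<in> {{0}}"
    then show "M \<in> Lat 0"
      by (auto simp: Lat_def full_rank_def submod_def V_def scl_def fun_eq_iff)
  qed
  then show ?thesis by (simp add: weight_sum_def nn_integral_count_space_finite)
qed

text \<open>By \<open>card_tails\<close>, the tail count is \<open>q\<close> to the sum of the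
  exponents from \<open>c m\<close> on, which is absorbed as a factor \<open>q\<close> in each of
  those variables. The admissible \<open>k\<close> start at \<open>diag M (c m)\<close> if
  \<open>h\<close> hits \<open>m\<close>; starting the geometric series there produces
  \<open>w m ^ diag M (c m)\<close>, absorbed into the variable of \<open>c m\<close>.\<close>

lemma weight_sum_Suc:
  "weight_sum (Suc m) w = (\<Sum>j. w m ^ j) *
    weight_sum m (\<lambda>i. w i * (if c m \<le> i then of_nat q else 1) * (if m \<in> range h \<and> i = c m then w m else 1))"
    (is "_ = _ * weight_sum m ?w")
proof -
  let ?p = "\<lambda>M. \<Prod>i<m. w i ^ diag M i"
  have "weight_sum (Suc m) w = (\<integral>\<^sup>+z. (\<Prod>i<Suc m. w i ^ diag ((\<lambda>(M, k, b). ext m M k b) z) i)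
      \<partial>count_space (SIGMA M:Lat m. SIGMA k:UNIV. tails m M k))"
    unfolding weight_sum_def by (rule nn_integral_bij_count_space[OF bij_betw_ext, symmetric])
  also have "\<dots> = (\<integral>\<^sup>+z. ?p (fst z) * w m ^ fst (snd z)
      \<partial>count_space (SIGMA M:Lat m. SIGMA k:UNIV. tails m M k))"
    by (intro nn_integral_cong) (auto simp: diag_ext split: prod.splits)
  also have "\<dots> = (\<integral>\<^sup>+M. (\<integral>\<^sup>+z. ?p M * w m ^ fst z \<partial>count_space (SIGMA k:UNIV. tails m M k)) \<partial>count_space (Lat m))"
    by (rule nn_integral_count_space_Sigma[where f = "\<lambda>M z. ?p M * w m ^ fst z"])
  also have "\<dots> = (\<integral>\<^sup>+M. (\<Sum>j. w m ^ j) * (\<Prod>i<m. ?w i ^ diag M i) \<partial>count_space (Lat m))"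
  proof (rule nn_integral_cong)
    fix M assume "M \<in> space (count_space (Lat m))"
    then have M: "M \<in> Lat m" by simp
    \<comment> \<open>The least exponent for which tails exist; from there on their number does not
      depend on \<open>k\<close>.\<close>
    define k0 where "k0 = (if m \<in> range h then diag M (c m) else 0)"
    define Q :: ennreal where "Q = of_nat q ^ (\<Sum>i\<in>{c m..<m}. diag M i)"
    have c_less: "c m < m" if "m \<in> range h" using that h_gt c_h by auto
    have "(\<integral>\<^sup>+z. ?p M * w m ^ fst z \<partial>count_space (SIGMA k:UNIV. tails m M k)) =
        (\<integral>\<^sup>+k. (\<integral>\<^sup>+b. ?p M * w m ^ k \<partial>count_space (tails m M k)) \<partial>count_space UNIV)"
      by (rule nn_integral_count_space_Sigma[where f = "\<lambda>k b. ?p M * w m ^ k"])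
    also have "\<dots> = (\<Sum>k. ?p M * w m ^ k * of_nat (card (tails m M k)))"
      by (simp add: nn_integral_count_space_nat finite_tails)
    also have "\<dots> = (\<Sum>k. ?p M * Q * (if k0 \<le> k then w m ^ k else 0))"
      by (intro arg_cong[of _ _ suminf] ext) (auto simp: card_tails[OF M] k0_def Q_def mult_ac)
    also have "\<dots> = ?p M * Q * (\<Sum>k. if k0 \<le> k then w m ^ k else 0)"
      by (rule ennreal_suminf_cmult)
    also have "(\<Sum>k. if k0 \<le> k then w m ^ k else 0) = (\<Sum>j. w m ^ (j + k0))"
    proof -
      have "(\<lambda>j. (if k0 \<le> j + k0 then w m ^ (j + k0) else 0)) sums (\<Sum>j. w m ^ (j + k0))"
        using summable_sums[of "\<lambda>j. w m ^ (j + k0)"] by simp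
      then have "(\<lambda>k. if k0 \<le> k then w m ^ k else 0) sums (\<Sum>j. w m ^ (j + k0))"
        using sums_mono_reindex[of "\<lambda>j. j + k0" "\<lambda>k. if k0 \<le> k then w m ^ k else 0"]
        by (force simp: strict_mono_def image_iff le_iff_add add.commute)
      then show ?thesis by (rule sums_unique[symmetric])
    qed
    also have "\<dots> = w m ^ k0 * (\<Sum>j. w m ^ j)"
      by (simp add: power_add mult.commute)
    also have "?p M * Q * (w m ^ k0 * (\<Sum>j. w m ^ j)) = (\<Sum>j. w m ^ j) * (?p M * Q * w m ^ k0)"
      by (simp add: mult_ac)
    also have "Q = (\<Prod>i<m. (if c m \<le> i then of_nat q else 1) ^ diag M i)"
    proof -
      have "(\<Prod>i<m. (if c m \<le> i then of_nat q else 1) ^ diag M i) = (\<Prod>i\<in>{c m..<m}. (of_nat q :: ennreal) ^ diag M i)"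
        by (intro prod.mono_neutral_cong_right) auto
      then show ?thesis by (simp add: Q_def power_sum)
    qed
    also have "w m ^ k0 = (\<Prod>i<m. (if m \<in> range h \<and> i = c m then w m else 1) ^ diag M i)"
    proof (cases "m \<in> range h")
      case True
      have "(\<Prod>i<m. (if m \<in> range h \<and> i = c m then w m else 1) ^ diag M i) =
          (\<Prod>i\<in>{c m}. w m ^ diag M i)"
        using True c_less[OF True] by (intro prod.mono_neutral_cong_right) auto
      then show ?thesis using True by (simp add: k0_def)
    qed (simp add: k0_def)
    also have "?p M * (\<Prod>i<m. (if c m \<le> i then of_nat q else 1) ^ diag M i) *
        (\<Prod>i<m. (if m \<in> range h \<and> i = c m then w m else 1) ^ diag M i) = (\<Prod>i<m. ?w i ^ diag M i)"
      by (simp only: prod.distrib[symmetric] power_mult_distrib)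
    finally show "(\<integral>\<^sup>+z. ?p M * w m ^ fst z \<partial>count_space (SIGMA k:UNIV. tails m M k)) =
      (\<Sum>j. w m ^ j) * (\<Prod>i<m. ?w i ^ diag M i)" .
  qed
  also have "\<dots> = (\<Sum>j. w m ^ j) * weight_sum m ?w"
    unfolding weight_sum_def by (rule nn_integral_cmult) simp
  finally show ?thesis .
qed

text \<open>For \<open>i < n\<close>, \<open>lev i\<close> is the number of indices below
  \<open>n\<close> in the chain \<open>i\<close>, \<open>h i\<close>, \<open>h (h i)\<close>, and so
  on. Iterating \<open>weight_sum_Suc\<close> from \<open>n\<close> down to 0 multiplies variables
  along these chains, which yields the exponent of \<open>y\<close>.\<close>

lemma weight_sum_const:
  assumes lev: "\<And>j. j < n \<Longrightarrow> lev j = (if h j < n then Suc (lev (h j)) else 1)"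
  shows "weight_sum n (\<lambda>_. y) = (\<Prod>i<n. \<Sum>j. (of_nat q ^ (n - Suc i) * y ^ lev i) ^ j)"
proof -
  \<comment> \<open>The variable of index \<open>i\<close> once the indices from \<open>m\<close> to
    \<open>n - 1\<close> are removed. It stays \<open>y\<close> as long as \<open>h i < m\<close>.
    The removal of \<open>h i\<close> merges that variable into it, together with the powers of
    \<open>q\<close> collected so far, and every further removal adds one factor \<open>q\<close>.
    This explains why the power of \<open>q\<close> depends on \<open>m\<close> alone.\<close>
  define W where "W m i = (if i < c m then y else of_nat q ^ (n - m) * y ^ lev i)" for m i
  define G where "G i = (\<Sum>j. (of_nat q ^ (n - Suc i) * y ^ lev i) ^ j)" for i
  have "weight_sum n (\<lambda>_. y) = (\<Prod>i\<in>{m..<n}. G i) * weight_sum m (W m)" if "m \<le> n" for m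
    using that
  proof (induction rule: inc_induct)
    case base
    have "W n i = y" if "i < n" for i
      using that lev[of i] less_c_iff[of i n] by (auto simp: W_def)
    then have "weight_sum n (\<lambda>_. y) = weight_sum n (W n)" by (intro weight_sum_cong) simp
    then show ?case by simp
  next
    case (step m)
    have "c (Suc m) \<le> m" using less_c_iff[of m "Suc m"] h_gt[of m] by simp
    then have Wm: "W (Suc m) m = of_nat q ^ (n - Suc m) * y ^ lev m" by (simp add: W_def)
    have nm: "n - m = Suc (n - Suc m)" using step by simp
    have "W (Suc m) i * (if c m \<le> i then of_nat q else 1) * (if m \<in> range h \<and> i = c m then W (Suc m) m else 1)
        = W m i" if i: "i < m" for i
    proof (cases "i < c m")
      case True
      then have "i < c (Suc m)" using less_c_iff[of i m] less_c_iff[of i "Suc m"] by simp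
      then show ?thesis using True by (simp add: W_def)
    next
      case False
      then have ge: "h i \<ge> m" using less_c_iff[of i m] by simp
      show ?thesis
      proof (cases "h i = m")
        case True
        then have "i = c m" "m \<in> range h" "i < c (Suc m)" using c_h less_c_iff[of i "Suc m"] by auto
        moreover have "lev i = Suc (lev m)" using lev[of i] True i step by simp
        ultimately show ?thesis using Wm nm by (simp add: W_def mult_ac)
      next
        case ne: False
        then have "\<not> (m \<in> range h \<and> i = c m)" using c_h by auto
        moreover have "\<not> i < c (Suc m)" using ge ne less_c_iff[of i "Suc m"] by simp
        ultimately show ?thesis using False nm by (auto simp: W_def mult_ac)
      qed
    qed
    then have "weight_sum (Suc m) (W (Suc m)) = G m * weight_sum m (W m)"
      unfolding weight_sum_Suc G_def Wm[symmetric] by (intro arg_cong2[of _ _ _ _ "(*)"] weight_sum_cong refl) simp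
    moreover have "(\<Prod>i\<in>{m..<n}. G i) = (\<Prod>i\<in>{Suc m..<n}. G i) * G m"
      using step by (simp add: prod.atLeast_Suc_lessThan mult.commute)
    ultimately show ?case using step.IH by (simp add: mult.assoc)
  qed
  from this[of 0] show ?thesis by (simp add: weight_sum_0 G_def lessThan_atLeast0)
qed

definition colength :: "nat \<Rightarrow> (nat \<Rightarrow> 'a) set \<Rightarrow> nat"
  where "colength n M = (\<Sum>i<n. diag M i)"

text \<open>The submodules are sorted by colength. Their number is expressed as a measure with
  values up to infinity, because finiteness is obtained from this very series.\<close>

lemma weight_sum_const_suminf:
  "weight_sum n (\<lambda>_. y) = (\<Sum>N. y ^ N * emeasure (count_space UNIV) {M \<in> Lat n. colength n M = N})"
proof -
  let ?A = "\<lambda>N. {M \<in> Lat n. colength n M = N}"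
  have bij: "bij_betw snd (SIGMA N:UNIV. ?A N) (Lat n)"
    by (rule bij_betwI[where g = "\<lambda>M. (colength n M, M)"]) auto
  have "weight_sum n (\<lambda>_. y) = (\<integral>\<^sup>+M. y ^ colength n M \<partial>count_space (Lat n))"
    by (simp add: weight_sum_def colength_def power_sum)
  also have "\<dots> = (\<integral>\<^sup>+z. y ^ colength n (snd z) \<partial>count_space (SIGMA N:UNIV. ?A N))"
    by (rule nn_integral_bij_count_space[OF bij, symmetric])
  also have "\<dots> = (\<integral>\<^sup>+z. y ^ fst z \<partial>count_space (SIGMA N:UNIV. ?A N))"
    by (intro nn_integral_cong) auto
  also have "\<dots> = (\<integral>\<^sup>+N. (\<integral>\<^sup>+M. y ^ N \<partial>count_space (?A N)) \<partial>count_space UNIV)"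
    by (rule nn_integral_count_space_Sigma[where f = "\<lambda>N M. y ^ N"])
  also have "\<dots> = (\<Sum>N. y ^ N * emeasure (count_space UNIV) (?A N))"
    by (simp add: nn_integral_count_space_nat emeasure_count_space)
  finally show ?thesis .
qed

text \<open>From \<open>q ^ n * y < 1\<close> one gets \<open>y \<le> 1\<close>, and as
  \<open>lev i\<close> is at least 1, every geometric ratio is below 1 and the product is finite. A
  nonnegative series with finite sum and positive powers of \<open>y\<close> cannot have an infinite
  coefficient, so the sets are finite and the identity descends to the reals.\<close>

lemma colength_series:
  assumes lev: "\<And>j. j < n \<Longrightarrow> lev j = (if h j < n then Suc (lev (h j)) else 1)"
    and y: "0 < y" "real q ^ n * y < 1"
  shows "finite {M \<in> Lat n. colength n M = N}"
    and "(\<lambda>N. real (card {M \<in> Lat n. colength n M = N}) * y ^ N) sums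
      (\<Prod>i<n. 1 / (1 - real q ^ (n - Suc i) * y ^ lev i))"
    and "i < n \<Longrightarrow> real q ^ (n - Suc i) * y ^ lev i < 1"
proof -
  let ?A = "\<lambda>N. {M \<in> Lat n. colength n M = N}"
  let ?x = "\<lambda>i. real q ^ (n - Suc i) * y ^ lev i"
  have q1: "1 \<le> real q" using q_ge_2 by simp
  have "1 * y \<le> real q ^ n * y" using y one_le_power[OF q1, of n] by (intro mult_right_mono) auto
  then have y1: "y \<le> 1" using y by linarith
  show x1: "?x i < 1" if "i < n" for i
  proof -
    have "1 \<le> lev i" using lev[OF that] by auto
    then have "y ^ lev i \<le> y ^ 1" using y y1 by (intro power_decreasing) auto
    moreover have "real q ^ (n - Suc i) \<le> real q ^ n" using q1 by (intro power_increasing) auto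
    ultimately have "?x i \<le> real q ^ n * y" using y by (intro mult_mono) auto
    then show ?thesis using y by simp
  qed
  have x0: "0 \<le> ?x i" for i using y by simp
  define p where "p = (\<Prod>i<n. 1 / (1 - ?x i))"
  have p0: "0 \<le> p" unfolding p_def using x1 by (intro prod_nonneg) (auto simp: less_imp_le)
  have geom: "(\<Sum>j. (of_nat q ^ (n - Suc i) * ennreal y ^ lev i) ^ j) = ennreal (1 / (1 - ?x i))" if "i < n" for i
  proof -
    have "of_nat q ^ (n - Suc i) * ennreal y ^ lev i = ennreal (?x i)"
      using y by (simp add: ennreal_of_nat_eq_real_of_nat ennreal_power ennreal_mult)
    then have "(of_nat q ^ (n - Suc i) * ennreal y ^ lev i) ^ j = ennreal (?x i ^ j)" for j
      using x0 by (simp only: ennreal_power)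
    then have "(\<Sum>j. (of_nat q ^ (n - Suc i) * ennreal y ^ lev i) ^ j) = (\<Sum>j. ennreal (?x i ^ j))"
      by (simp only:)
    also have "\<dots> = ennreal (1 / (1 - ?x i))"
    proof (rule suminf_ennreal_eq)
      have "norm (?x i) < 1" using x0[of i] x1[OF that] by (simp only: real_norm_def abs_of_nonneg)
      then show "(\<lambda>j. ?x i ^ j) sums (1 / (1 - ?x i))" by (rule geometric_sums)
      show "0 \<le> ?x i ^ j" for j using x0[of i] by (rule zero_le_power)
    qed
    finally show ?thesis .
  qed
  have "weight_sum n (\<lambda>_. ennreal y) =
      (\<Prod>i<n. \<Sum>j. (of_nat q ^ (n - Suc i) * ennreal y ^ lev i) ^ j)"
    by (rule weight_sum_const) (rule lev)
  also have "\<dots> = (\<Prod>i<n. ennreal (1 / (1 - ?x i)))"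
    by (rule prod.cong[OF refl], rule geom) simp
  also have "\<dots> = ennreal p"
    unfolding p_def using x1 by (intro prod_ennreal) (auto simp: less_imp_le)
  finally have *: "(\<Sum>N. ennreal y ^ N * emeasure (count_space UNIV) (?A N)) = ennreal p"
    using weight_sum_const_suminf by simp
  show fin: "finite (?A N)" for N
  proof (rule ccontr)
    assume "infinite (?A N)"
    then have "ennreal y ^ N * emeasure (count_space UNIV) (?A N) = \<infinity>"
      using y by (simp add: emeasure_count_space_infinite ennreal_mult_top)
    moreover have "ennreal y ^ N * emeasure (count_space UNIV) (?A N) < \<infinity>"
      by (rule ennreal_suminf_lessD) (simp add: *)
    ultimately show False by simp
  qed
  have "ennreal y ^ N * emeasure (count_space UNIV) (?A N) = ennreal (real (card (?A N)) * y ^ N)" for N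
    using y fin by (simp add: emeasure_count_space_finite ennreal_of_nat_eq_real_of_nat ennreal_power ennreal_mult mult.commute)
  then have **: "(\<Sum>N. ennreal (real (card (?A N)) * y ^ N)) = ennreal p" using * by simp
  have sm: "summable (\<lambda>N. real (card (?A N)) * y ^ N)"
    using ** y by (intro summable_suminf_not_top) auto
  have "ennreal (\<Sum>N. real (card (?A N)) * y ^ N) = ennreal p"
    using ** y sm by (subst suminf_ennreal2[symmetric]) auto
  moreover have "0 \<le> (\<Sum>N. real (card (?A N)) * y ^ N)" using y by (intro suminf_nonneg sm) simp
  ultimately have "(\<Sum>N. real (card (?A N)) * y ^ N) = p" using p0 by simp
  then show "(\<lambda>N. real (card (?A N)) * y ^ N) sums (\<Prod>i<n. 1 / (1 - ?x i))"
    using summable_sums[OF sm] by (simp only: p_def)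
qed

end

section \<open>Power series of rational functions\<close>

text \<open>Multiplication by a two-term polynomial is a shift, a scaling and a subtraction, so
  convergence at the single point \<open>z\<close> is preserved. Absolute convergence, as for a
  general Cauchy product, does not enter, and boundary points of the disc are covered.\<close>

lemma sums_fps_one_minus_monom_mult:
  fixes F :: "complex fps"
  assumes "(\<lambda>N. fps_nth F N * z ^ N) sums s"
  shows "(\<lambda>N. fps_nth ((1 - fps_const b * fps_X ^ l) * F) N * z ^ N) sums ((1 - b * z ^ l) * s)"
proof -
  let ?f = "\<lambda>N. fps_nth (fps_X ^ l * F) N * z ^ N"
  have "(\<lambda>N. z ^ l * (fps_nth F N * z ^ N)) sums (z ^ l * s)" by (rule sums_mult[OF assms])
  moreover have "z ^ l * (fps_nth F N * z ^ N) = ?f (N + l)" for N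
    unfolding fps_X_power_mult_nth by (simp add: power_add)
  ultimately have "(\<lambda>N. ?f (N + l)) sums (z ^ l * s)" by (simp only:)
  then have "?f sums (z ^ l * s)"
    by (subst (asm) sums_zero_iff_shift) (simp_all add: fps_X_power_mult_nth)
  then have "(\<lambda>N. fps_nth F N * z ^ N - b * ?f N) sums (s - b * (z ^ l * s))"
    by (intro sums_diff assms sums_mult)
  moreover have "fps_nth F N * z ^ N - b * ?f N = fps_nth ((1 - fps_const b * fps_X ^ l) * F) N * z ^ N" for N
  proof -
    have "(1 - fps_const b * fps_X ^ l) * F = F - fps_const b * (fps_X ^ l * F)"
      by (simp add: algebra_simps)
    then have "fps_nth ((1 - fps_const b * fps_X ^ l) * F) N = fps_nth F N - b * fps_nth (fps_X ^ l * F) N"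
      by simp
    then show ?thesis by (simp only: left_diff_distrib mult.assoc)
  qed
  moreover have "s - b * (z ^ l * s) = (1 - b * z ^ l) * s" by (simp add: algebra_simps)
  ultimately show ?thesis by (simp only:)
qed

lemma sums_fps_one: "(\<lambda>N. fps_nth (1 :: complex fps) N * z ^ N) sums 1"
proof -
  have "(\<lambda>N. fps_nth (1 :: complex fps) N * z ^ N) = (\<lambda>N. if N = 0 then 1 else 0)"
    by (auto simp: fun_eq_iff)
  then show ?thesis using sums_single[of 0 "\<lambda>_. 1::complex"] by simp
qed

lemma sums_fps_prod_mult:
  fixes F :: "complex fps"
  assumes "finite I" "(\<lambda>N. fps_nth F N * z ^ N) sums s"
  shows "(\<lambda>N. fps_nth ((\<Prod>i\<in>I. 1 - fps_const (b i) * fps_X ^ l i) * F) N * z ^ N)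
    sums ((\<Prod>i\<in>I. 1 - b i * z ^ l i) * s)"
  using assms
proof (induction I rule: finite_induct)
  case (insert i I)
  then show ?case
    using sums_fps_one_minus_monom_mult[OF insert.IH[OF insert.prems], of "b i" "l i"]
    by (simp add: mult.assoc)
qed simp

text \<open>Zeros of a nonzero power series are isolated, whereas here they would accumulate at 0
  along the positive axis.\<close>

lemma powser_eq_0_if_vanishes_right_of_0:
  fixes a :: "nat \<Rightarrow> complex"
  assumes r: "0 < r" and sums0: "\<And>y. 0 < y \<Longrightarrow> y < r \<Longrightarrow> (\<lambda>N. a N * of_real y ^ N) sums 0"
  shows "a m = 0"
proof (rule ccontr)
  assume am: "a m \<noteq> 0"
  \<comment> \<open>Multiplying the series by \<open>z\<close> makes it vanish at 0 and moves a
    nonzero coefficient to a positive index, as \<open>powser_0_nonzero\<close> requires.\<close>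
  define a' where "a' N = (if N = 0 then 0 else a (N - 1))" for N
  define f where "f z = (\<Sum>N. a' N * z ^ N)" for z
  have sums': "(\<lambda>N. a' N * z ^ N) sums (z * s)" if "(\<lambda>N. a N * z ^ N) sums s" for z s
  proof -
    have "(\<lambda>N. a' (Suc N) * z ^ Suc N) sums (z * s)"
      using sums_mult[OF that, of z] by (simp add: a'_def mult_ac)
    then show ?thesis by (subst (asm) sums_Suc_iff) (simp add: a'_def)
  qed
  have f0: "f (of_real y) = 0" if "0 < y" "y < r" for y
    using sums'[OF sums0[OF that]] by (simp add: f_def sums_iff)
  have "(\<lambda>N. a' N * z ^ N) sums f z" if "norm z < r / 2" for z
  proof -
    have "summable (\<lambda>N. a N * of_real (r / 2) ^ N)" using sums0[of "r / 2"] r by (simp add: sums_iff)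
    then have "summable (\<lambda>N. a N * z ^ N)" by (rule powser_inside) (use that r in simp)
    then have "summable (\<lambda>N. a' N * z ^ N)" using sums' summable_sums sums_summable by blast
    then show ?thesis unfolding f_def by (rule summable_sums)
  qed
  moreover have "f 0 = 0" by (simp add: f_def a'_def)
  moreover have "a' (Suc m) \<noteq> 0" using am by (simp add: a'_def)
  ultimately obtain s where s: "0 < s" "\<And>z. z \<in> cball 0 s - {0} \<Longrightarrow> f z \<noteq> 0"
    using powser_0_nonzero[of "r / 2" 0 a' f "Suc m"] r by auto
  define y where "y = min s (r / 2)"
  have "0 < y" "y < r" "y \<le> s" using s r by (auto simp: y_def)
  then show False using f0[of y] s(2)[of "of_real y"] by simp
qed

text \<open>The identity on a small real interval becomes the formal identity
  \<open>Q * F = 1\<close>, and this can be evaluated at every complex point where the series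
  converges.\<close>

lemma powser_eq_rational:
  fixes a :: "nat \<Rightarrow> real"
  assumes I: "finite I" and r: "0 < r"
    and small: "\<And>y i. 0 < y \<Longrightarrow> y < r \<Longrightarrow> i \<in> I \<Longrightarrow> b i * y ^ l i < 1"
    and sums: "\<And>y. 0 < y \<Longrightarrow> y < r \<Longrightarrow> (\<lambda>N. a N * y ^ N) sums (\<Prod>i\<in>I. 1 / (1 - b i * y ^ l i))"
    and z: "summable (\<lambda>N. of_real (a N) * z ^ N)"
  shows "(\<Sum>N. of_real (a N) * z ^ N) = 1 / (\<Prod>i\<in>I. 1 - of_real (b i) * (z::complex) ^ l i)"
proof -
  define F :: "complex fps" where "F = Abs_fps (\<lambda>N. of_real (a N))"
  define Q where "Q = (\<Prod>i\<in>I. 1 - fps_const (complex_of_real (b i)) * fps_X ^ l i)"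
  have "(\<lambda>N. fps_nth (Q * F - 1) N * of_real y ^ N) sums 0" if y: "0 < y" "y < r" for y
  proof -
    define p where "p = (\<Prod>i\<in>I. 1 - b i * y ^ l i)"
    have "p \<noteq> 0" unfolding p_def using small[OF y] I by fastforce
    have "(\<lambda>N. complex_of_real (a N * y ^ N)) sums of_real (1 / p)"
      using sums[OF y] by (intro sums_of_real) (simp add: p_def prod_dividef)
    then have F: "(\<lambda>N. fps_nth F N * of_real y ^ N) sums of_real (1 / p)" by (simp add: F_def)
    have "(\<lambda>N. fps_nth (Q * F) N * of_real y ^ N) sums 1"
    proof -
      have "(\<Prod>i\<in>I. 1 - complex_of_real (b i) * of_real y ^ l i) = of_real p"
        by (simp add: p_def)
      then have "(\<Prod>i\<in>I. 1 - complex_of_real (b i) * of_real y ^ l i) * of_real (1 / p) = 1"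
        using \<open>p \<noteq> 0\<close> by simp
      then show ?thesis
        using sums_fps_prod_mult[OF I F, of "\<lambda>i. of_real (b i)" l] by (simp only: Q_def)
    qed
    moreover have "(\<lambda>N. fps_nth (1 :: complex fps) N * of_real y ^ N) sums 1" by (rule sums_fps_one)
    ultimately have "(\<lambda>N. fps_nth (Q * F) N * of_real y ^ N - fps_nth 1 N * of_real y ^ N) sums (1 - 1)"
      by (rule sums_diff)
    then show ?thesis by (simp add: algebra_simps)
  qed
  then have "fps_nth (Q * F - 1) m = 0" for m by (rule powser_eq_0_if_vanishes_right_of_0[OF r])
  then have QF: "Q * F = 1" by (simp add: fps_eq_iff)
  have "(\<lambda>N. fps_nth F N * z ^ N) sums (\<Sum>N. of_real (a N) * z ^ N)"
    using summable_sums[OF z] by (simp add: F_def)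
  from sums_fps_prod_mult[OF I this, of "\<lambda>i. of_real (b i)" l]
  have "(\<lambda>N. fps_nth (1 :: complex fps) N * z ^ N) sums
      ((\<Prod>i\<in>I. 1 - of_real (b i) * z ^ l i) * (\<Sum>N. of_real (a N) * z ^ N))"
    using QF by (simp add: Q_def)
  moreover have "(\<lambda>N. fps_nth (1 :: complex fps) N * z ^ N) sums 1" by (rule sums_fps_one)
  ultimately have "(\<Prod>i\<in>I. 1 - of_real (b i) * z ^ l i) * (\<Sum>N. of_real (a N) * z ^ N) = 1"
    by (rule sums_unique2)
  \<comment> \<open>The product being 1 also shows that the denominator does not vanish at
    \<open>z\<close>, so the division is a genuine one.\<close>
  then show ?thesis by (metis eq_divide_imp mult_zero_left mult.commute zero_neq_one)
qed

section \<open>Finite extensions of the \<open>p\<close>-adic numbers\<close>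

lemma Rep_padic_int_of_nat: "Rep_padic_int (of_nat k :: 'p::prime_card padic_int) n = int k mod int CARD('p) ^ n"
  by (induction k) (simp_all add: zero_padic_int.rep_eq plus_padic_int.rep_eq one_padic_int.rep_eq mod_simps)

lemma Rep_padic_int_of_int: "Rep_padic_int (of_int m :: 'p::prime_card padic_int) n = m mod int CARD('p) ^ n"
proof (cases m rule: int_cases2)
  case (nonneg k)
  then show ?thesis by (simp add: Rep_padic_int_of_nat)
next
  case (nonpos k)
  then show ?thesis by (simp add: Rep_padic_int_of_nat uminus_padic_int.rep_eq mod_simps)
qed

lemma prime_card_gt_1: "1 < real CARD('p::prime_card)"
  using prime_card[where 'a = 'p] prime_gt_1_nat by auto

lemma padic_int_abs_le_iff:
  "padic_int_abs (x :: 'p::prime_card padic_int) \<le> 1 / real CARD('p) ^ k \<longleftrightarrow> Rep_padic_int x k = 0"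
proof (cases "x = 0")
  case False
  have "1 / real CARD('p) ^ padic_ord x \<le> 1 / real CARD('p) ^ k \<longleftrightarrow> k \<le> padic_ord x"
    using prime_card_gt_1[where 'p = 'p] by (simp add: divide_simps)
  then show ?thesis using False Rep_padic_int_eq_0_iff[OF False] by (simp add: padic_int_abs_def)
qed (simp add: padic_int_abs_def zero_padic_int.rep_eq)

lemma of_int_fract: "(of_int m :: 'a::idom fract) = Fract (of_int m) 1"
  by (cases m rule: int_cases2) (simp_all add: of_nat_fract)

lemma padic_abs_of_int_dvd:
  assumes "int CARD('p::prime_card) dvd m"
  shows "padic_abs (of_int m :: 'p padic) \<le> 1 / real CARD('p)"
proof -
  have "padic_int_abs (1 :: 'p padic_int) = 1"
    using padic_int_abs_mult[of "1 :: 'p padic_int" 1] padic_int_abs_eq_0_iff[of "1 :: 'p padic_int"] by simp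
  moreover have "padic_int_abs (of_int m :: 'p padic_int) \<le> 1 / real CARD('p) ^ 1"
    unfolding padic_int_abs_le_iff Rep_padic_int_of_int using assms by simp
  ultimately show ?thesis by (simp add: of_int_fract padic_abs_Fract)
qed

lemma padic_abs_prime: "padic_abs (of_nat CARD('p::prime_card) :: 'p padic) = 1 / real CARD('p)"
proof -
  let ?x = "of_nat CARD('p) :: 'p padic_int"
  have p: "1 < int CARD('p)" using prime_card[where 'a = 'p] prime_gt_1_nat by auto
  have R1: "Rep_padic_int ?x 1 = 0" by (simp add: Rep_padic_int_of_nat)
  have "int CARD('p) < int CARD('p) ^ 2" using p by (simp add: power2_eq_square)
  then have R2: "Rep_padic_int ?x 2 \<noteq> 0" using p by (simp add: Rep_padic_int_of_nat)
  then have x0: "?x \<noteq> 0" by (auto simp: zero_padic_int.rep_eq)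
  have "padic_ord ?x = 1"
    using R1 R2 Rep_padic_int_eq_0_iff[OF x0, of 1] Rep_padic_int_eq_0_iff[OF x0, of 2] by linarith
  moreover have "padic_int_abs (1 :: 'p padic_int) = 1"
    using padic_int_abs_mult[of "1 :: 'p padic_int" 1] padic_int_abs_eq_0_iff[of "1 :: 'p padic_int"] by simp
  ultimately show ?thesis using x0 by (simp add: of_nat_fract padic_abs_Fract padic_int_abs_def)
qed

text \<open>Every p-adic number of absolute value at most 1 is congruent to an integer modulo
  \<open>p\<close>. For a fraction of \<open>a\<close> by \<open>b\<close>, both are divisible by
  \<open>p ^ j\<close> with \<open>j\<close> the order of \<open>b\<close>; what remains of
  \<open>b\<close> is a unit modulo \<open>p\<close>.\<close>

lemma padic_approx_int:
  fixes x :: "'p::prime_card padic"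
  assumes "padic_abs x \<le> 1"
  obtains m :: int where "padic_abs (x - of_int m) \<le> 1 / real CARD('p)"
proof -
  let ?p = "int CARD('p)"
  have prime: "prime ?p" by (rule prime_card_int)
  obtain a b where x: "x = Fract a b" and b: "b \<noteq> 0" by (cases x) auto
  define j where "j = padic_ord b"
  have absb: "padic_int_abs b = 1 / real CARD('p) ^ j" using b by (simp add: padic_int_abs_def j_def)
  have pos: "0 < padic_int_abs b" using prime_card_gt_1[where 'p = 'p] absb by simp
  have "padic_int_abs a \<le> padic_int_abs b"
    using assms b pos by (simp add: x padic_abs_Fract divide_le_eq_1)
  then have "padic_int_abs a \<le> 1 / real CARD('p) ^ j" by (simp only: absb)
  then have "Rep_padic_int a (Suc j) mod ?p ^ j = 0"
    by (simp add: padic_int_abs_le_iff Rep_padic_int_Suc_mod)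
  then obtain u where u: "Rep_padic_int a (Suc j) = ?p ^ j * u" by (auto simp: mod_eq_0_iff_dvd dvd_def)
  have "Rep_padic_int b (Suc j) mod ?p ^ j = 0"
    using Rep_padic_int_eq_0_iff[OF b, of j] by (simp add: Rep_padic_int_Suc_mod j_def)
  then obtain w where w: "Rep_padic_int b (Suc j) = ?p ^ j * w" by (auto simp: mod_eq_0_iff_dvd dvd_def)
  have "\<not> ?p dvd w"
  proof
    assume "?p dvd w"
    then have "?p ^ Suc j dvd Rep_padic_int b (Suc j)" by (auto simp: w dvd_def)
    then show False using padic_ord_dvd_iff[OF b, of "Suc j" "Suc j"] by (simp add: j_def)
  qed
  then have "coprime w ?p" using prime prime_imp_coprime coprime_commute by blast
  then obtain e where e: "[w * e = 1] (mod ?p)" using cong_solve_coprime_int by blast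
  \<comment> \<open>\<open>e\<close> inverts the unit part \<open>w\<close> of \<open>b\<close>
    modulo \<open>p\<close>, so \<open>m\<close> represents the quotient of the reduced numerator by
    the reduced denominator.\<close>
  define m where "m = e * u"
  have "?p dvd u * (1 - w * e)"
    using e by (simp add: cong_iff_dvd_diff dvd_diff_commute)
  then have "?p ^ j * ?p dvd ?p ^ j * (u * (1 - w * e))" by (intro mult_dvd_mono) auto
  moreover have "?p ^ j * (u * (1 - w * e)) = ?p ^ j * u - m * (?p ^ j * w)"
    by (simp add: m_def algebra_simps)
  ultimately have dvd: "?p ^ Suc j dvd ?p ^ j * u - m * (?p ^ j * w)"
    by (simp only: power_Suc2)
  have "Rep_padic_int (a - of_int m * b) (Suc j) =
      (Rep_padic_int a (Suc j) - m * Rep_padic_int b (Suc j)) mod ?p ^ Suc j"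
    by (simp only: minus_padic_int.rep_eq times_padic_int.rep_eq Rep_padic_int_of_int mod_simps)
  also have "\<dots> = 0" unfolding u w using dvd by (simp only: dvd_eq_mod_eq_0)
  finally have "padic_int_abs (a - of_int m * b) \<le> 1 / real CARD('p) ^ Suc j"
    by (simp only: padic_int_abs_le_iff)
  then have "padic_int_abs (a - of_int m * b) / padic_int_abs b \<le>
      (1 / real CARD('p) ^ Suc j) / (1 / real CARD('p) ^ j)"
    unfolding absb by (rule divide_right_mono) simp
  moreover have "x - of_int m = Fract (a - of_int m * b) b"
    using b by (simp add: x of_int_fract)
  then have "padic_abs (x - of_int m) = padic_int_abs (a - of_int m * b) / padic_int_abs b"
    by (simp only: padic_abs_Fract[OF b])
  ultimately have "padic_abs (x - of_int m) \<le> (1 / real CARD('p) ^ Suc j) / (1 / real CARD('p) ^ j)"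
    by (simp only:)
  then have "padic_abs (x - of_int m) \<le> 1 / real CARD('p)"
    using prime_card_gt_1[where 'p = 'p] by (simp add: field_simps)
  then show ?thesis by (rule that)
qed

section \<open>Finiteness of the residue field and discreteness of the valuation\<close>

locale padic_extension = nonarch_valuation v
  for \<iota> :: "'p::prime_card padic \<Rightarrow> 'k::field" and v :: "'k \<Rightarrow> real" +
  assumes padic: "padic_field \<iota> v"
begin

text \<open>The absolute value of \<open>p\<close>; \<open>v (x - y) \<le> \<epsilon>\<close>
  expresses congruence modulo \<open>p\<close>.\<close>

definition \<epsilon> :: real
  where "\<epsilon> = v (\<iota> (of_nat CARD('p)))"

sublocale \<iota>: field_hom \<iota>
  using padic by (simp add: padic_field_def)

lemma v_\<iota>: "v (\<iota> x) = padic_abs x"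
  using padic by (simp add: padic_field_def)

lemma \<epsilon>_eq: "\<epsilon> = 1 / real CARD('p)"
  by (simp only: \<epsilon>_def v_\<iota> padic_abs_prime)

lemma \<epsilon>: "0 < \<epsilon>" "\<epsilon> < 1"
  using prime_card_gt_1[where 'p = 'p] by (simp_all add: \<epsilon>_eq)

lemma v_of_int_dvd: "int CARD('p) dvd m \<Longrightarrow> v (of_int m) \<le> \<epsilon>"
  using padic_abs_of_int_dvd[where 'p = 'p, of m] v_\<iota>[of "of_int m"] by (simp add: \<iota>.hom_of_int \<epsilon>_eq)

lemma v_prime: "v (of_nat CARD('p)) = \<epsilon>"
  by (simp only: \<epsilon>_def \<iota>.hom_of_nat)

lemma v_of_int: "v (of_int m) \<le> 1"
proof -
  have nat: "v (of_nat k) \<le> 1" for k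
  proof (induction k)
    case (Suc k)
    then show ?case using v_add[of 1 "of_nat k"] by simp
  qed simp
  show ?thesis by (cases m rule: int_cases2) (simp_all add: nat)
qed

lemma \<epsilon>_nonneg [simp]: "0 \<le> \<epsilon>"
  using \<epsilon> by simp

lemma v_of_int_mult_dvd:
  assumes "int CARD('p) dvd m" "x \<in> valuation_ring v"
  shows "v (of_int m * x) \<le> \<epsilon>"
proof -
  have "v (of_int m) * v x \<le> \<epsilon> * 1"
    using v_of_int_dvd[OF assms(1)] assms(2) by (intro mult_mono) (auto simp: valuation_ring_def)
  then show ?thesis by (simp add: v_mult)
qed

text \<open>Linear independence over the prime field of residues modulo \<open>p\<close>.\<close>

definition residually_independent :: "'k set \<Rightarrow> bool"
  where "residually_independent S \<longleftrightarrow> finite S \<and> S \<subseteq> valuation_ring v \<and>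
    (\<forall>a. v (\<Sum>s\<in>S. of_int (a s) * s) \<le> \<epsilon> \<longrightarrow> (\<forall>s\<in>S. int CARD('p) dvd a s))"

text \<open>Residual independence implies linear independence over the p-adic numbers, so the degree
  is a bound. A linear relation is divided by its coefficient of largest absolute value; the
  coefficients become p-integral, one of them equal to 1, and replacing them by integers gives a
  relation modulo \<open>p\<close> in which that one is not divisible by \<open>p\<close>.\<close>

lemma residually_independent_card:
  "\<exists>d. \<forall>S. residually_independent S \<longrightarrow> card S \<le> d"
proof -
  obtain B where B: "finite_dimensional_vector_space (\<lambda>c x. \<iota> c * x) B"
    using padic by (auto simp: padic_field_def)
  interpret E: finite_dimensional_vector_space "\<lambda>c x. \<iota> c * x" B by (rule B)
  have "card S \<le> card B" if S: "residually_independent S" for S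
  proof -
    have fin: "finite S" and SR: "S \<subseteq> valuation_ring v" using S by (auto simp: residually_independent_def)
    have "E.independent S"
    proof
      assume "E.dependent S"
      then obtain u where u: "\<exists>s\<in>S. u s \<noteq> 0" "(\<Sum>s\<in>S. \<iota> (u s) * s) = 0"
        using E.dependent_finite[OF fin] by auto
      define V where "V = (\<lambda>s. v (\<iota> (u s))) ` S"
      have V: "finite V" "V \<noteq> {}" using fin u by (auto simp: V_def)
      have "Max V \<in> (\<lambda>s. v (\<iota> (u s))) ` S" using Max_in[OF V] by (simp only: V_def)
      then obtain s0 where s0: "s0 \<in> S" "Max V = v (\<iota> (u s0))" by (elim imageE)
      have max: "v (\<iota> (u s)) \<le> v (\<iota> (u s0))" if "s \<in> S" for s
        unfolding s0(2)[symmetric] using V that by (intro Max_ge) (auto simp: V_def)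
      obtain s1 where "s1 \<in> S" "u s1 \<noteq> 0" using u by blast
      then have "0 < v (\<iota> (u s1))" by simp
      then have "0 < v (\<iota> (u s0))" using max[OF \<open>s1 \<in> S\<close>] by linarith
      then have us0: "\<iota> (u s0) \<noteq> 0" by (rule v_pos[THEN iffD1])
      then have us0': "u s0 \<noteq> 0" using \<iota>.hom_zero by metis
      define c where "c s = u s / u s0" for s
      have c1: "padic_abs (c s) \<le> 1" if "s \<in> S" for s
        using max[OF that] us0 by (simp add: c_def v_\<iota>[symmetric] \<iota>.hom_div v_divide divide_le_eq_1)
      define m where "m s = (SOME m::int. padic_abs (c s - of_int m) \<le> \<epsilon>)" for s
      have m: "padic_abs (c s - of_int (m s)) \<le> \<epsilon>" if s: "s \<in> S" for s
      proof -
        obtain k where "padic_abs (c s - of_int k) \<le> \<epsilon>" using padic_approx_int[OF c1[OF s]] unfolding \<epsilon>_eq by blast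
        then show ?thesis unfolding m_def by (rule someI)
      qed
      then have m': "v (\<iota> (c s) - of_int (m s)) \<le> \<epsilon>" if "s \<in> S" for s
        using that by (simp add: v_\<iota>[symmetric] \<iota>.hom_minus \<iota>.hom_of_int)
      have "(\<Sum>s\<in>S. \<iota> (c s) * s) = (\<Sum>s\<in>S. \<iota> (u s) * s) / \<iota> (u s0)"
        by (simp add: c_def \<iota>.hom_div sum_divide_distrib)
      then have c0: "(\<Sum>s\<in>S. \<iota> (c s) * s) = 0" using u by simp
      have "(\<Sum>s\<in>S. of_int (m s) * s) = - (\<Sum>s\<in>S. (\<iota> (c s) - of_int (m s)) * s)"
        using c0 by (simp add: left_diff_distrib sum_subtractf)
      moreover have "v (\<Sum>s\<in>S. (\<iota> (c s) - of_int (m s)) * s) \<le> \<epsilon>"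
      proof (rule v_sum_le)
        fix s assume "s \<in> S"
        then have "v (\<iota> (c s) - of_int (m s)) * v s \<le> \<epsilon> * 1"
          using m' SR \<epsilon> by (intro mult_mono) (auto simp: valuation_ring_def)
        then show "v ((\<iota> (c s) - of_int (m s)) * s) \<le> \<epsilon>" by (simp add: v_mult)
      qed simp
      ultimately have "v (\<Sum>s\<in>S. of_int (m s) * s) \<le> \<epsilon>" by simp
      then have "int CARD('p) dvd m s0" using S s0 unfolding residually_independent_def by blast
      then have "v (of_int (m s0)) \<le> \<epsilon>" by (rule v_of_int_dvd)
      moreover have "\<iota> (c s0) = 1" using us0' by (simp add: c_def)
      then have "v (1 - of_int (m s0)) \<le> \<epsilon>" using m'[OF s0(1)] by simp
      ultimately have "v (1 - of_int (m s0) + of_int (m s0)) \<le> \<epsilon>"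
        using v_add[of "1 - of_int (m s0)" "of_int (m s0)"] by linarith
      then show False using \<epsilon> by simp
    qed
    then show ?thesis
      using E.independent_span_bound[OF E.finite_Basis, of S] E.span_Basis by simp
  qed
  then show ?thesis by blast
qed

text \<open>A residually independent set of maximal size spans the valuation ring modulo
  \<open>p\<close>, so the finitely many combinations with coefficients in \<open>{0..<p}\<close>
  suffice.\<close>

lemma finite_residues_mod_p:
  obtains F where "finite F" "\<And>x. x \<in> valuation_ring v \<Longrightarrow> \<exists>f\<in>F. v (x - f) \<le> \<epsilon>"
proof -
  have prime: "prime (int CARD('p))" by (rule prime_card_int)
  obtain d where d: "\<And>S. residually_independent S \<Longrightarrow> card S \<le> d"
    using residually_independent_card by blast
  have "residually_independent {}" by (simp add: residually_independent_def)
  then obtain S where S: "residually_independent S" and max: "\<And>T. residually_independent T \<Longrightarrow> card T \<le> card S"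
    using ex_has_greatest_nat[of residually_independent "{}" card "Suc d"] d by (metis le_imp_less_Suc)
  have fin: "finite S" and SR: "S \<subseteq> valuation_ring v" using S by (auto simp: residually_independent_def)
  define F where "F = (\<lambda>a. \<Sum>s\<in>S. of_int (a s) * s) ` (S \<rightarrow>\<^sub>E {0..<int CARD('p)})"
  have approx: "\<exists>f\<in>F. v (x - f) \<le> \<epsilon>" if x: "v (x - (\<Sum>s\<in>S. of_int (a s) * s)) \<le> \<epsilon>" for x a
  proof -
    define b where "b s = (if s \<in> S then a s mod int CARD('p) else undefined)" for s
    have "b \<in> S \<rightarrow>\<^sub>E {0..<int CARD('p)}" using prime by (auto simp: b_def prime_gt_0_int)
    then have "(\<Sum>s\<in>S. of_int (b s) * s) \<in> F" by (auto simp: F_def)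
    moreover have "v (\<Sum>s\<in>S. of_int (a s - b s) * s) \<le> \<epsilon>"
    proof (rule v_sum_le)
      fix s assume s: "s \<in> S"
      then have "int CARD('p) dvd a s - b s" by (simp add: b_def)
      then show "v (of_int (a s - b s) * s) \<le> \<epsilon>" using s SR by (intro v_of_int_mult_dvd) auto
    qed simp
    then have "v ((x - (\<Sum>s\<in>S. of_int (a s) * s)) + (\<Sum>s\<in>S. of_int (a s - b s) * s)) \<le> \<epsilon>"
      using x v_add[of "x - (\<Sum>s\<in>S. of_int (a s) * s)" "\<Sum>s\<in>S. of_int (a s - b s) * s"] by linarith
    then have "v (x - (\<Sum>s\<in>S. of_int (b s) * s)) \<le> \<epsilon>"
      by (simp add: left_diff_distrib sum_subtractf)
    ultimately show ?thesis by blast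
  qed
  have "\<exists>f\<in>F. v (x - f) \<le> \<epsilon>" if xR: "x \<in> valuation_ring v" for x
  proof (cases "x \<in> S")
    case True
    have "(\<Sum>s\<in>S. of_int (if s = x then 1 else 0) * s) = (\<Sum>s\<in>S. if s = x then x else 0)"
      by (intro sum.cong) auto
    also have "\<dots> = x" using True fin by simp
    finally show ?thesis using approx[of x "\<lambda>s. if s = x then 1 else 0"] \<epsilon> by simp
  next
    case False
    then have "card (insert x S) > card S" using fin by simp
    then have "\<not> residually_independent (insert x S)" using max by fastforce
    then obtain a where a: "v (\<Sum>s\<in>insert x S. of_int (a s) * s) \<le> \<epsilon>" "\<not> (\<forall>s\<in>insert x S. int CARD('p) dvd a s)"
      using fin SR xR unfolding residually_independent_def by auto
    let ?y = "\<Sum>s\<in>S. of_int (a s) * s"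
    have ax: "v (of_int (a x) * x + ?y) \<le> \<epsilon>" using a(1) fin False by simp
    have "\<not> int CARD('p) dvd a x"
    proof
      assume dvd: "int CARD('p) dvd a x"
      then have "v (of_int (a x) * x) \<le> \<epsilon>" by (rule v_of_int_mult_dvd[OF _ xR])
      then have "v ((of_int (a x) * x + ?y) - of_int (a x) * x) \<le> \<epsilon>"
        using v_diff[of "of_int (a x) * x + ?y" "of_int (a x) * x"] ax by linarith
      then have "\<forall>s\<in>S. int CARD('p) dvd a s" using S unfolding residually_independent_def by simp
      then show False using dvd a(2) by blast
    qed
    \<comment> \<open>The coefficient of \<open>x\<close> in the new relation can be inverted modulo
      \<open>p\<close>, and solving for \<open>x\<close> expresses it by \<open>S\<close>.\<close>
    then have "coprime (a x) (int CARD('p))" using prime prime_imp_coprime coprime_commute by blast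
    then obtain e where e: "[a x * e = 1] (mod int CARD('p))" using cong_solve_coprime_int by blast
    then have "int CARD('p) dvd 1 - e * a x" by (simp add: cong_iff_dvd_diff dvd_diff_commute mult.commute)
    then have 1: "v (of_int (1 - e * a x) * x) \<le> \<epsilon>" by (rule v_of_int_mult_dvd[OF _ xR])
    have "v (of_int e) * v (of_int (a x) * x + ?y) \<le> 1 * \<epsilon>"
      using v_of_int ax by (intro mult_mono) auto
    then have 2: "v (of_int e * (of_int (a x) * x + ?y)) \<le> \<epsilon>" by (simp add: v_mult)
    have eq: "x - (\<Sum>s\<in>S. of_int (- e * a s) * s) =
        of_int (1 - e * a x) * x + of_int e * (of_int (a x) * x + ?y)"
      by (simp add: algebra_simps sum_distrib_left sum_negf)
    have "v (x - (\<Sum>s\<in>S. of_int (- e * a s) * s)) \<le> \<epsilon>"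
      unfolding eq by (rule order_trans[OF v_add max.boundedI[OF 1 2]])
    then show ?thesis by (rule approx)
  qed
  moreover have "finite F" unfolding F_def using fin by (intro finite_imageI finite_PiE) auto
  ultimately show ?thesis by (intro that)
qed

text \<open>Since \<open>\<epsilon> < 1\<close>, congruence modulo \<open>p\<close> is finer than
  congruence modulo the maximal ideal.\<close>

lemma finite_residue_field: 
  "finite (valuation_ring v // {(x, y). x \<in> valuation_ring v \<and> y \<in> valuation_ring v \<and> v (x - y) < 1})"
proof -
  let ?r = "{(x, y). x \<in> valuation_ring v \<and> y \<in> valuation_ring v \<and> v (x - y) < 1}"
  obtain F where F: "finite F" "\<And>x. x \<in> valuation_ring v \<Longrightarrow> \<exists>f\<in>F. v (x - f) \<le> \<epsilon>"
    using finite_residues_mod_p by blast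
  have "valuation_ring v // ?r \<subseteq> (\<lambda>f. {y \<in> valuation_ring v. v (f - y) < 1}) ` F"
  proof
    fix C assume "C \<in> valuation_ring v // ?r"
    then obtain x where x: "x \<in> valuation_ring v" "C = ?r `` {x}" by (auto simp: quotient_def)
    then obtain f where f: "f \<in> F" "v (x - f) \<le> \<epsilon>" using F by blast
    have "v (x - y) < 1 \<longleftrightarrow> v (f - y) < 1" for y
      using f(2) \<epsilon> v_add[of "x - f" "f - y"] v_diff[of "x - y" "x - f"] by auto
    then have "C = {y \<in> valuation_ring v. v (f - y) < 1}" using x by auto
    then show "C \<in> (\<lambda>f. {y \<in> valuation_ring v. v (f - y) < 1}) ` F" using f by blast
  qed
  then show ?thesis using F(1) finite_surj by blast
qed

text \<open>If \<open>\<epsilon> < v x\<close> and \<open>f\<close> is congruent to \<open>x\<close>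
  modulo \<open>p\<close>, then \<open>v f = v x\<close>. Values between \<epsilon> and 1 are
  therefore attained on a finite set, and adding \<open>p\<close> itself to that set covers the
  values up to \<epsilon>.\<close>

lemma ex_uniformizer: "\<exists>t. 0 < v t \<and> v t < 1 \<and> (\<forall>x. v x < 1 \<longrightarrow> v x \<le> v t)"
proof -
  obtain F where F: "finite F" "\<And>x. x \<in> valuation_ring v \<Longrightarrow> \<exists>f\<in>F. v (x - f) \<le> \<epsilon>"
    using finite_residues_mod_p by blast
  define Z where "Z = {f \<in> insert (of_nat CARD('p)) F. v f < 1}"
  have Z: "finite Z" "of_nat CARD('p) \<in> Z" using F(1) v_prime \<epsilon> by (auto simp: Z_def)
  then have "finite (v ` Z)" "v ` Z \<noteq> {}" by auto
  then obtain t where t: "t \<in> Z" "v t = Max (v ` Z)" using Max_in by (metis imageE)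
  have max: "v f \<le> v t" if "f \<in> Z" for f unfolding t(2) using Z that by (intro Max_ge) auto
  have "v x \<le> v t" if x: "v x < 1" for x
  proof (cases "v x \<le> \<epsilon>")
    case True
    then show ?thesis using max[OF Z(2)] v_prime by simp
  next
    case False
    have "x \<in> valuation_ring v" using x by (simp add: valuation_ring_def)
    then obtain f where f: "f \<in> F" "v (x - f) \<le> \<epsilon>" using F by blast
    have "v f = v x" using f False v_diff[of x "x - f"] v_add[of "x - f" f] by auto
    then show ?thesis using max[of f] f x by (simp add: Z_def)
  qed
  moreover have "0 < v t" using max[OF Z(2)] v_prime \<epsilon> by linarith
  moreover have "v t < 1" using t by (simp add: Z_def)
  ultimately show ?thesis by blast
qed

end

section \<open>The basis indexed by the cells of a Young diagram\<close>

lemma sum_list_take_Suc: "b < length ms \<Longrightarrow> sum_list (take (Suc b) ms) = sum_list (take b ms) + (ms ! b :: nat)"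
  by (simp add: take_Suc_conv_app_nth)

lemma sum_list_take_mono:
  fixes ms :: "nat list"
  assumes "a \<le> b"
  shows "sum_list (take a ms) \<le> sum_list (take b ms)"
proof -
  have "take a ms = take a (take b ms)" using assms by (simp add: min_absorb1)
  then show ?thesis
    by (metis append_take_drop_id le_add1 sum_list_append)
qed

lemma block_position_less:
  fixes ms :: "nat list"
  assumes "b < length ms" "i < ms ! b" "b < b'"
  shows "sum_list (take b ms) + i < sum_list (take b' ms)"
proof -
  have "sum_list (take b ms) + i < sum_list (take (Suc b) ms)" using assms by (simp add: sum_list_take_Suc)
  also have "\<dots> \<le> sum_list (take b' ms)" using assms by (intro sum_list_take_mono) simp
  finally show ?thesis .
qed

lemma block_position_less_sum:
  fixes ms :: "nat list"
  assumes "b < length ms" "i < ms ! b"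
  shows "sum_list (take b ms) + i < sum_list ms"
  using block_position_less[OF assms assms(1)] by simp

lemma block_position_bij:
  fixes ms :: "nat list"
  shows "bij_betw (\<lambda>(b, i). sum_list (take b ms) + i) {(b, i). b < length ms \<and> i < ms ! b} {..<sum_list ms}"
  unfolding bij_betw_def
proof
  show "inj_on (\<lambda>(b, i). sum_list (take b ms) + i) {(b, i). b < length ms \<and> i < ms ! b}"
  proof (rule inj_onI)
    fix z z' assume "z \<in> {(b, i). b < length ms \<and> i < ms ! b}" "z' \<in> {(b, i). b < length ms \<and> i < ms ! b}"
      and "(\<lambda>(b, i). sum_list (take b ms) + i) z = (\<lambda>(b, i). sum_list (take b ms) + i) z'"
    then obtain b i b' i' where z: "z = (b, i)" "z' = (b', i')" "b < length ms" "i < ms ! b" "b' < length ms" "i' < ms ! b'"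
      and eq: "sum_list (take b ms) + i = sum_list (take b' ms) + i'" by auto
    have "\<not> b < b'" "\<not> b' < b" using block_position_less[of b ms i b'] block_position_less[of b' ms i' b] z eq by auto
    then show "z = z'" using z eq by simp
  qed
  have "\<exists>b<length ms. \<exists>i<ms ! b. j = sum_list (take b ms) + i" if "j < sum_list ms" for j
    using that
  proof (induction ms arbitrary: j)
    case (Cons m ms)
    show ?case
    proof (cases "j < m")
      case True
      then show ?thesis by (intro exI[of _ 0]) simp
    next
      case False
      then have "j - m < sum_list ms" using Cons.prems by simp
      then obtain b i where "b < length ms" "i < ms ! b" "j - m = sum_list (take b ms) + i" using Cons.IH by blast
      then show ?thesis using False by (intro exI[of _ "Suc b"]) auto
    qed
  qed simp
  then show "(\<lambda>(b, i). sum_list (take b ms) + i) ` {(b, i). b < length ms \<and> i < ms ! b} = {..<sum_list ms}"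
    using block_position_less_sum by (fastforce simp: image_iff)
qed

lemma dim_nilpotent_matrix [simp]:
  "dim_row (nilpotent_matrix ms :: 'k::field mat) = sum_list ms"
  "dim_col (nilpotent_matrix ms :: 'k::field mat) = sum_list ms"
  by (induction ms) (simp_all add: nilpotent_matrix_def companion_X_power_def Let_def)

lemma nilpotent_matrix_entry:
  assumes "b < length ms" "i < ms ! b" "r < sum_list ms"
  shows "(nilpotent_matrix ms :: 'k::field mat) $$ (r, sum_list (take b ms) + i) =
    (if 0 < i \<and> Suc r = sum_list (take b ms) + i then 1 else 0)"
  using assms
proof (induction ms arbitrary: b r)
  case (Cons m ms)
  let ?N = "nilpotent_matrix ms :: 'k mat" and ?C = "companion_X_power m :: 'k mat"
  have N: "nilpotent_matrix (m # ms) = four_block_mat ?C (0\<^sub>m m (sum_list ms)) (0\<^sub>m (sum_list ms) m) ?N"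
    using dim_nilpotent_matrix[of ms, where 'k = 'k]
    by (simp add: nilpotent_matrix_def Let_def companion_X_power_def)
  have C: "dim_row ?C = m" "dim_col ?C = m" by (simp_all add: companion_X_power_def)
  define j where "j = sum_list (take b (m # ms)) + i"
  have j: "j < m + sum_list ms"
    using block_position_less_sum[OF Cons.prems(1,2)] by (simp add: j_def)
  have r: "r < m + sum_list ms" using Cons.prems by simp
  have entry: "nilpotent_matrix (m # ms) $$ (r, j) =
      (if r < m then if j < m then ?C $$ (r, j) else 0 else if j < m then 0 else ?N $$ (r - m, j - m))"
    unfolding N using j r by (subst index_mat_four_block) (auto simp: C)
  have "nilpotent_matrix (m # ms) $$ (r, j) = (if 0 < i \<and> Suc r = j then 1 else (0::'k))"
  proof (cases b)
    case 0
    then show ?thesis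
      using entry Cons.prems j_def by (auto simp: companion_X_power_def)
  next
    case (Suc b')
    then have b': "b' < length ms" "i < ms ! b'" using Cons.prems by auto
    have jm: "j = m + (sum_list (take b' ms) + i)" by (simp add: j_def Suc)
    show ?thesis
    proof (cases "r < m")
      case True
      then show ?thesis using entry jm by auto
    next
      case False
      then have "r - m < sum_list ms" using r by simp
      then show ?thesis
        using entry False jm Cons.IH[OF b', of "r - m"] by auto
    qed
  qed
  then show ?case by (simp only: j_def)
qed simp

lemma row_mult_nilpotent_matrix:
  assumes "b < length ms" "i < ms ! b" "x \<in> carrier_vec (sum_list ms)"
  shows "vec_index (row_mult x (nilpotent_matrix ms)) (sum_list (take b ms) + i) =
    (if i = 0 then 0 else vec_index x (sum_list (take b ms) + (i - 1)) :: 'k::field)"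
proof -
  let ?n = "sum_list ms" and ?j = "sum_list (take b ms) + i"
  have j: "?j < ?n" by (rule block_position_less_sum[OF assms(1,2)])
  have "vec_index (row_mult x (nilpotent_matrix ms)) ?j =
      (\<Sum>r\<in>{0..<?n}. vec_index x r * nilpotent_matrix ms $$ (r, ?j))"
    using j assms(3) by (simp add: row_mult_def scalar_prod_def)
  also have "\<dots> = (\<Sum>r\<in>{0..<?n}. if 0 < i \<and> Suc r = ?j then vec_index x r else 0)"
    using nilpotent_matrix_entry[OF assms(1,2), where 'k = 'k] by (intro sum.cong) auto
  also have "\<dots> = (if i = 0 then 0 else vec_index x (sum_list (take b ms) + (i - 1)))"
  proof (cases "i = 0")
    case False
    then have "Suc r = ?j \<longleftrightarrow> r = sum_list (take b ms) + (i - 1)" for r by auto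
    then show ?thesis using False j by (simp add: sum.delta)
  qed simp
  finally show ?thesis .
qed

section \<open>Rows and cells of the Young diagram\<close>

locale partition =
  fixes l :: "nat list" and n :: nat
  assumes partition: "is_partition n l" and n_pos: "0 < n"
begin

abbreviation S :: "nat \<Rightarrow> nat"
  where "S i \<equiv> sum_list (take i l)"

lemma l_nonempty: "l \<noteq> []"
  using partition n_pos by (auto simp: is_partition_def)

lemma sum_l: "sum_list l = n"
  using partition by (simp add: is_partition_def)

lemma l_pos: "i < length l \<Longrightarrow> 0 < l ! i"
  using partition by (simp add: is_partition_def)

lemma l_antimono: "i \<le> j \<Longrightarrow> j < length l \<Longrightarrow> l ! j \<le> l ! i"
  using partition by (cases "i = j") (auto simp: is_partition_def sorted_wrt_iff_nth_less)

lemma partition_inv_props: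
  assumes "a \<le> n"
  shows "1 \<le> partition_inv l a" "partition_inv l a \<le> length l" "a \<le> S (partition_inv l a)"
    "1 \<le> i \<Longrightarrow> i \<le> length l \<Longrightarrow> a \<le> S i \<Longrightarrow> partition_inv l a \<le> i"
proof -
  let ?A = "{i \<in> {1..length l}. a \<le> S i}"
  have "length l \<in> ?A" using assms l_nonempty sum_l by (simp add: Suc_le_eq)
  then have "partition_inv l a \<in> ?A" unfolding partition_inv_def by (intro Min_in) auto
  then show "1 \<le> partition_inv l a" "partition_inv l a \<le> length l" "a \<le> S (partition_inv l a)" by auto
  show "partition_inv l a \<le> i" if "1 \<le> i" "i \<le> length l" "a \<le> S i"
    unfolding partition_inv_def using that by (intro Min_le) auto
qed

lemma partition_inv_eqI:
  assumes "i < length l" "S i < a" "a \<le> S (Suc i)"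
  shows "partition_inv l a = Suc i"
proof -
  have "S (Suc i) \<le> S (length l)" using assms by (intro sum_list_take_mono) simp
  then have "a \<le> n" using assms sum_l by simp
  note p = partition_inv_props[OF this]
  have "\<not> partition_inv l a \<le> i"
  proof
    assume "partition_inv l a \<le> i"
    then have "S (partition_inv l a) \<le> S i" by (rule sum_list_take_mono)
    then show False using p(3) assms by simp
  qed
  moreover have "partition_inv l a \<le> Suc i" using p(4) assms by simp
  ultimately show ?thesis by simp
qed

lemma partition_inv_cases:
  assumes "0 < a" "a \<le> n"
  obtains i where "i < length l" "S i < a" "a \<le> S (Suc i)" "partition_inv l a = Suc i"
proof -
  note p = partition_inv_props[OF assms(2)]
  define i where "i = partition_inv l a - 1"
  have i: "partition_inv l a = Suc i" "i < length l" using p(1,2) by (simp_all add: i_def)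
  have "S i < a"
  proof (cases "i = 0")
    case False
    then show ?thesis using p(4)[of i] i by force
  qed (use assms in simp)
  then show ?thesis using that i p(3) by simp
qed

lemma partition_inv_mono: "a \<le> a' \<Longrightarrow> a' \<le> n \<Longrightarrow> partition_inv l a \<le> partition_inv l a'"
  using partition_inv_props[of a] partition_inv_props[of a'] by (meson le_trans)

text \<open>The basis vectors are numbered such that those of the \<open>i\<close>-th row of the Young diagram of \<open>l\<close>
  come after those of the rows below it, and \<open>shift\<close> is the move to the cell directly above.\<close>

definition shift :: "nat \<Rightarrow> nat"
  where "shift j = j + l ! (partition_inv l (n - j) - 1)"

text \<open>The row number of cell \<open>j\<close>, counted from 1 at the top. The cells are
  numbered from the bottom row, hence the argument \<open>n - j\<close>.\<close>

definition level :: "nat \<Rightarrow> nat"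
  where "level j = partition_inv l (n - j)"

lemma level_index: "partition_inv l (n - j) - 1 < length l"
  using partition_inv_props[of "n - j"] by simp

lemma shift_gt: "j < shift j"
  using l_pos[OF level_index] by (simp add: shift_def)

text \<open>A larger index lies in the same or a higher row, which is at least as long, so the
  amount added never decreases. Beyond the diagram the truncated \<open>n - j\<close> is 0 and
  counts as the top row, which keeps the map monotone on all naturals.\<close>

lemma strict_mono_shift: "strict_mono shift"
proof (rule strict_monoI)
  fix j j' :: nat assume "j < j'"
  then have "partition_inv l (n - j') - 1 \<le> partition_inv l (n - j) - 1"
    using partition_inv_mono[of "n - j'" "n - j"] by (intro diff_le_mono) simp
  then have "l ! (partition_inv l (n - j) - 1) \<le> l ! (partition_inv l (n - j') - 1)"
    using level_index by (rule l_antimono)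
  then show "shift j < shift j'" using \<open>j < j'\<close> by (simp add: shift_def)
qed

text \<open>The recursion that \<open>weight_sum_const\<close> demands of \<open>lev\<close>: a step
  upwards lowers the row number by one and leaves the diagram exactly from the top row.\<close>

lemma level_eq:
  assumes "j < n"
  shows "level j = (if shift j < n then Suc (level (shift j)) else 1)"
proof -
  obtain i where i: "i < length l" "S i < n - j" "n - j \<le> S (Suc i)" "partition_inv l (n - j) = Suc i"
    using partition_inv_cases[of "n - j"] assms by auto
  have sj: "shift j = j + l ! i" using i by (simp add: shift_def)
  show ?thesis
  proof (cases i)
    case 0
    then have "n - j \<le> l ! i" using i(3) sum_list_take_Suc[OF i(1)] by simp
    then show ?thesis using sj i 0 by (simp add: level_def)
  next
    case (Suc i')
    have 1: "S (Suc i) = S i + l ! i" "S i = S i' + l ! i'"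
      using sum_list_take_Suc[OF i(1)] sum_list_take_Suc[of i' l] i Suc by auto
    have 2: "l ! i \<le> l ! i'" using l_antimono[of i' i] i Suc by simp
    have "S i' < n - shift j" "n - shift j \<le> S (Suc i')"
      using 1 2 i sj Suc by auto
    moreover from this have "shift j < n" by simp
    ultimately show ?thesis using partition_inv_eqI[of i' "n - shift j"] i Suc by (simp add: level_def)
  qed
qed

text \<open>Pairs of column and row, column first: columns are the Jordan blocks, and the row is the
  position inside the block.\<close>

definition cells :: "(nat \<times> nat) set"
  where "cells = {(b, i). i < length l \<and> b < l ! i}"

text \<open>The rows strictly below row \<open>i\<close> contain \<open>n - S (Suc i)\<close> cells.
  As rows are left-aligned, the cell above differs by exactly the length of row
  \<open>i\<close>.\<close>

definition cell_index :: "nat \<times> nat \<Rightarrow> nat"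
  where "cell_index = (\<lambda>(b, i). n - S (Suc i) + b)"

lemma S_Suc_le: "i < length l \<Longrightarrow> S (Suc i) \<le> n"
  using sum_list_take_mono[of "Suc i" "length l" l] sum_l by simp

lemma cell_index_props:
  assumes "(b, i) \<in> cells"
  shows "n - cell_index (b, i) = S (Suc i) - b" "cell_index (b, i) < n"
    "partition_inv l (n - cell_index (b, i)) = Suc i" "shift (cell_index (b, i)) = n - S i + b"
proof -
  have i: "i < length l" "b < l ! i" using assms by (auto simp: cells_def)
  have Suc: "S (Suc i) = S i + l ! i" by (rule sum_list_take_Suc[OF i(1)])
  have le: "S (Suc i) \<le> n" by (rule S_Suc_le[OF i(1)])
  show 1: "n - cell_index (b, i) = S (Suc i) - b" "cell_index (b, i) < n"
    using le i Suc by (auto simp: cell_index_def)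
  show 2: "partition_inv l (n - cell_index (b, i)) = Suc i"
    unfolding 1 using i Suc by (intro partition_inv_eqI) auto
  show "shift (cell_index (b, i)) = n - S i + b"
    using 2 le Suc by (simp add: shift_def cell_index_def)
qed

lemma bij_cell_index: "bij_betw cell_index cells {..<n}"
  unfolding bij_betw_def
proof
  show "inj_on cell_index cells"
  proof (rule inj_onI)
    fix z z' assume z: "z \<in> cells" "z' \<in> cells" "cell_index z = cell_index z'"
    obtain b i b' i' where zz: "z = (b, i)" "z' = (b', i')" by fastforce
    have "i = i'" using cell_index_props(3)[of b i] cell_index_props(3)[of b' i'] z zz by simp
    then show "z = z'" using z zz by (simp add: cell_index_def)
  qed
  show "cell_index ` cells = {..<n}"
  proof (intro equalityI subsetI)
    fix j assume "j \<in> {..<n}"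
    then obtain i where i: "i < length l" "S i < n - j" "n - j \<le> S (Suc i)"
      using partition_inv_cases[of "n - j"] by auto
    have "S (Suc i) = S i + l ! i" by (rule sum_list_take_Suc[OF i(1)])
    then have "(S (Suc i) - (n - j), i) \<in> cells" using i by (auto simp: cells_def)
    moreover have "cell_index (S (Suc i) - (n - j), i) = j"
      using i S_Suc_le[OF i(1)] \<open>j \<in> {..<n}\<close> by (simp add: cell_index_def)
    ultimately show "j \<in> cell_index ` cells" by force
  qed (use cell_index_props(2) in auto)
qed

text \<open>Row lengths do not increase, so the rows that reach column \<open>b\<close> form an
  initial segment, and its length is the part of the dual partition at \<open>b\<close>.\<close>

lemma cells_dual: "cells = {(b, i). b < length (dual_partition l) \<and> i < dual_partition l ! b}"
proof -
  have len: "length (dual_partition l) = l ! 0"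
    using l_nonempty by (simp add: dual_partition_def hd_conv_nth)
  have nth: "i < dual_partition l ! b \<longleftrightarrow> i < length l \<and> b < l ! i" if "b < l ! 0" for b i
  proof -
    have "dual_partition l ! b = length (filter (\<lambda>x. Suc b \<le> x) l)"
      using that l_nonempty by (simp add: dual_partition_def hd_conv_nth del: upt_Suc)
    also have "\<dots> = card {k. k < length l \<and> b < l ! k}"
      by (simp add: length_filter_conv_card Suc_le_eq)
    finally have d: "dual_partition l ! b = card {k. k < length l \<and> b < l ! k}" (is "_ = card ?K") .
    have fin: "finite ?K" by simp
    show ?thesis
    proof
      assume i: "i < dual_partition l ! b"
      show "i < length l \<and> b < l ! i"
      proof (rule ccontr)
        assume neg: "\<not> (i < length l \<and> b < l ! i)"
        have "?K \<subseteq> {..<i}"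
        proof
          fix k assume k: "k \<in> ?K"
          show "k \<in> {..<i}"
          proof (rule ccontr)
            assume "k \<notin> {..<i}"
            then have "i \<le> k" by simp
            then show False using l_antimono[of i k] k neg by auto
          qed
        qed
        then have "card ?K \<le> card {..<i}" by (intro card_mono) auto
        then show False using i d by simp
      qed
    next
      assume i: "i < length l \<and> b < l ! i"
      have "{..i} \<subseteq> ?K"
      proof
        fix k assume "k \<in> {..i}"
        then show "k \<in> ?K" using l_antimono[of k i] i by force
      qed
      then have "card {..i} \<le> card ?K" by (intro card_mono fin)
      then show "i < dual_partition l ! b" using d by simp
    qed
  qed
  show ?thesis
  proof (rule Set.set_eqI)
    fix z :: "nat \<times> nat"
    obtain b i where z: "z = (b, i)" by fastforce
    have "b < l ! i \<Longrightarrow> i < length l \<Longrightarrow> b < l ! 0" using l_antimono[of 0 i] by simp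
    then show "z \<in> cells \<longleftrightarrow> z \<in> {(b, i). b < length (dual_partition l) \<and> i < dual_partition l ! b}"
      using nth[of b i] z by (auto simp: cells_def len)
  qed
qed

lemma sum_dual_partition: "sum_list (dual_partition l) = n"
  using bij_betw_same_card[OF bij_cell_index] bij_betw_same_card[OF block_position_bij[of "dual_partition l"]]
  by (simp add: cells_dual)

text \<open>\<tau> passes from the numbering by blocks, in which the matrix is given, to the
  numbering by rows, in which the shift is monotone.\<close>

lemma ex_renumbering:
  "\<exists>\<tau>. bij_betw \<tau> {..<n} {..<n} \<and> (\<forall>(x :: 'k::field vec)\<in>carrier_vec n. \<forall>y.
      (\<forall>j<n. vec_index x j = y (\<tau> j)) \<longrightarrow> (\<forall>j\<ge>n. y j = 0) \<longrightarrow>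
      row_mult x (nilpotent_matrix (dual_partition l)) = vec n (\<lambda>j. y (shift (\<tau> j))))"
proof -
  let ?m = "dual_partition l"
  define \<alpha> :: "nat \<times> nat \<Rightarrow> nat" where "\<alpha> = (\<lambda>(b, i). sum_list (take b ?m) + i)"
  have \<alpha>: "bij_betw \<alpha> cells {..<n}"
    using block_position_bij[of ?m] unfolding \<alpha>_def cells_dual[symmetric] sum_dual_partition .
  define \<tau> where "\<tau> = cell_index \<circ> inv_into cells \<alpha>"
  have \<tau>_\<alpha>: "\<tau> (\<alpha> z) = cell_index z" if "z \<in> cells" for z
    using that \<alpha> by (simp add: \<tau>_def bij_betw_def inv_into_f_f)
  have "bij_betw \<tau> {..<n} {..<n}"
    unfolding \<tau>_def using bij_betw_inv_into[OF \<alpha>] bij_cell_index by (rule bij_betw_trans)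
  moreover have "row_mult x (nilpotent_matrix ?m) = vec n (\<lambda>j. y (shift (\<tau> j)))"
    if x: "x \<in> carrier_vec n" and xy: "\<And>j. j < n \<Longrightarrow> vec_index x j = y (\<tau> j)" and y: "\<And>j. j \<ge> n \<Longrightarrow> y j = 0"
    for x :: "'k vec" and y
  proof (rule eq_vecI)
    show "dim_vec (row_mult x (nilpotent_matrix ?m)) = dim_vec (vec n (\<lambda>j. y (shift (\<tau> j))))"
      by (simp add: row_mult_def sum_dual_partition)
    fix j assume "j < dim_vec (vec n (\<lambda>j. y (shift (\<tau> j))))"
    then have j: "j < n" by simp
    then obtain b i where z: "(b, i) \<in> cells" "j = \<alpha> (b, i)"
      using \<alpha> unfolding bij_betw_def by (metis imageE lessThan_iff surj_pair)
    have bi: "b < length ?m" "i < ?m ! b" using z cells_dual by auto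
    have "vec_index (row_mult x (nilpotent_matrix ?m)) j =
        (if i = 0 then 0 else vec_index x (sum_list (take b ?m) + (i - 1)))"
      unfolding z(2) \<alpha>_def prod.case using bi x sum_dual_partition by (intro row_mult_nilpotent_matrix) auto
    also have "\<dots> = y (shift (\<tau> j))"
    proof (cases i)
      \<comment> \<open>The first column of a block is zero; correspondingly the cell lies in the
        top row, its shift is at least \<open>n\<close>, and \<open>y\<close> vanishes
        there.\<close>
      case 0
      then show ?thesis using y cell_index_props(4)[OF z(1)] \<tau>_\<alpha>[OF z(1)] z(2) by simp
    next
      case (Suc i')
      have z': "(b, i') \<in> cells" using bi Suc by (simp add: cells_dual)
      have "\<alpha> (b, i') < n" using \<alpha> z' by (auto simp: bij_betw_def)
      then have "vec_index x (\<alpha> (b, i')) = y (cell_index (b, i'))" using xy \<tau>_\<alpha>[OF z'] by simp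
      moreover have "shift (\<tau> j) = cell_index (b, i')"
        using cell_index_props(4)[OF z(1)] \<tau>_\<alpha>[OF z(1)] z(2) Suc by (simp add: cell_index_def)
      ultimately show ?thesis using Suc by (simp add: \<alpha>_def)
    qed
    finally show "vec_index (row_mult x (nilpotent_matrix ?m)) j = vec_index (vec n (\<lambda>j. y (shift (\<tau> j)))) j"
      using j by simp
  qed
  ultimately show ?thesis by (intro exI[of _ \<tau>]) blast
qed

end

section \<open>The zeta function\<close>

lemma bij_betw_quotient:
  assumes f: "bij_betw f A B" and r: "r \<subseteq> A \<times> A" and s: "s \<subseteq> B \<times> B"
    and rs: "\<And>x y. x \<in> A \<Longrightarrow> y \<in> A \<Longrightarrow> (f x, f y) \<in> s \<longleftrightarrow> (x, y) \<in> r"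
  shows "bij_betw (image f) (A // r) (B // s)"
  unfolding bij_betw_def
proof
  have fA: "f ` A = B" using f by (simp add: bij_betw_def)
  have "A // r \<subseteq> Pow A" using r by (auto simp: quotient_def)
  then show "inj_on ((`) f) (A // r)"
    using f inj_on_image_Pow inj_on_subset unfolding bij_betw_def by blast
  have "f ` (r `` {x}) = s `` {f x}" if "x \<in> A" for x
  proof (intro equalityI subsetI)
    fix y assume y: "y \<in> s `` {f x}"
    then obtain y' where "y' \<in> A" "y = f y'" using s fA by blast
    then show "y \<in> f ` (r `` {x})" using y rs that by blast
  qed (use r rs that in blast)
  then have "(`) f ` (A // r) = (\<lambda>x. s `` {f x}) ` A"
    unfolding quotient_def by (auto simp: image_iff)
  also have "\<dots> = B // s" unfolding fA[symmetric] by (auto simp: quotient_def)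
  finally show "(`) f ` (A // r) = B // s" .
qed

context finite_residue_valuation
begin

lemma card_quotient_full_rank:
  assumes "full_rank n M"
  shows "card (V n // {(x, y). x \<in> V n \<and> y \<in> V n \<and> x - y \<in> M}) = q ^ (\<Sum>i<n. diag M i)"
  using bij_betw_same_card[OF bij_betw_quotient_transversal[OF transversal_Box[OF assms]
      submod_subgroup[OF full_rank_submod[OF assms]]]] finite_card_Box by simp

text \<open>With finite index, the multiples by \<open>t ^ j\<close> of the basis vector at
  \<open>i\<close> cannot be pairwise incongruent modulo \<open>M\<close>. A congruent pair puts the
  nonzero element \<open>t ^ j - t ^ k\<close> into \<open>lead M i\<close>, which is then some
  \<open>P d\<close>.\<close>

lemma full_rank_if_finite_index:
  assumes M: "submod M" and MV: "M \<subseteq> V n"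
    and fin: "finite (V n // {(x, y). x \<in> V n \<and> y \<in> V n \<and> x - y \<in> M})"
  shows "full_rank n M"
  unfolding full_rank_def
proof (intro conjI allI impI M MV)
  fix i assume i: "i < n"
  let ?r = "{(x, y). x \<in> V n \<and> y \<in> V n \<and> x - y \<in> M}"
  define e :: "nat \<Rightarrow> nat \<Rightarrow> 'k" where "e j = (\<lambda>k. if k = i then t ^ j else 0)" for j
  have eV: "e j \<in> V (Suc i)" for j by (simp add: V_def e_def)
  then have eVn: "e j \<in> V n" for j using V_mono[of "Suc i" n] i by auto
  have "\<not> inj (\<lambda>j. ?r `` {e j})"
  proof
    assume "inj (\<lambda>j. ?r `` {e j})"
    moreover have "range (\<lambda>j. ?r `` {e j}) \<subseteq> V n // ?r" using eVn by (auto simp: quotient_def)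
    ultimately have "finite (UNIV :: nat set)" using fin inj_on_finite by blast
    then show False by simp
  qed
  then obtain j k where jk: "j \<noteq> k" "?r `` {e j} = ?r `` {e k}" by (auto simp: inj_def)
  have "e k \<in> ?r `` {e k}" using eVn submod_0[OF M] by simp
  then have eM: "e j - e k \<in> M" unfolding jk(2)[symmetric] by simp
  have "e j - e k \<in> V (Suc i)" using eV by (intro submod_diff submod_V)
  then have 1: "t ^ j - t ^ k \<in> lead M i"
    using eM unfolding lead_def by (intro image_eqI[of _ _ "e j - e k"]) (auto simp: e_def)
  have "t ^ j \<noteq> t ^ k" using jk(1) t_power_P[of j k] t_power_P[of j j] t_power_P[of k j] t_power_P[of k k]
    by (metis le_antisym nle_le)
  then have 2: "t ^ j - t ^ k \<noteq> 0" by simp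
  have "lead M i \<subseteq> R" by (auto simp: lead_def V_def)
  moreover have "c * y \<in> lead M i" if c: "c \<in> R" and y: "y \<in> lead M i" for c y
  proof -
    obtain x where x: "x \<in> M" "x \<in> V (Suc i)" "y = x i" using y by (auto simp: lead_def)
    then have "scl c x \<in> M \<inter> V (Suc i)" using c submod_scl M submod_V by blast
    moreover have "c * y = scl c x i" using x by (simp add: scl_def)
    ultimately show ?thesis unfolding lead_def by blast
  qed
  ultimately obtain d where "lead M i = P d" using ideal_is_P[OF _ 1 2] by blast
  then show "\<exists>d. lead M i = P d" by blast
qed

end

context nilpotent_shift
begin

text \<open>Relabelling coordinates by \<tau> carries functions to vectors and the shift to the
  matrix. The condition \<open>1 \<le> m\<close> excludes infinite index, to which
  \<open>card\<close> assigns 0, so the modules on the right have full rank.\<close>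

lemma bij_betw_invariant_submodules:
  fixes A :: "'a mat"
  assumes \<tau>: "bij_betw \<tau> {..<n} {..<n}" and dim: "dim_row A = n"
    and A: "\<forall>x\<in>carrier_vec n. \<forall>y. (\<forall>j<n. vec_index x j = y (\<tau> j)) \<longrightarrow> (\<forall>j\<ge>n. y j = 0) \<longrightarrow>
      row_mult x A = vec n (\<lambda>j. y (h (\<tau> j)))"
    and m: "1 \<le> m"
  shows "bij_betw (image (\<lambda>x. vec n (\<lambda>j. x (\<tau> j)))) {M \<in> Lat n. q ^ colength n M = m}
    (invariant_submodules_of_index R A m)"
proof -
  define \<psi> where "\<psi> x = vec n (\<lambda>j. x (\<tau> j))" for x :: "nat \<Rightarrow> 'a"
  have \<tau>_less: "\<tau> j < n" if "j < n" for j using \<tau> that by (auto simp: bij_betw_def)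
  have bij: "bij_betw \<psi> (V n) (free_module R n)"
  proof (rule bij_betwI[where g = "\<lambda>y i. if i < n then vec_index y (inv_into {..<n} \<tau> i) else 0"])
    have inv_less: "inv_into {..<n} \<tau> i < n" if "i < n" for i
      using \<tau> that inv_into_into[of i \<tau> "{..<n}"] by (simp add: bij_betw_def)
    show "\<psi> \<in> V n \<rightarrow> free_module R n" by (auto simp: \<psi>_def V_def free_module_def)
    show "(\<lambda>y i. if i < n then vec_index y (inv_into {..<n} \<tau> i) else 0) \<in> free_module R n \<rightarrow> V n"
      using inv_less by (auto simp: V_def free_module_def)
    show "(\<lambda>i. if i < n then vec_index (\<psi> x) (inv_into {..<n} \<tau> i) else 0) = x" if "x \<in> V n" for x
      using that inv_less \<tau> by (auto simp: \<psi>_def V_def fun_eq_iff bij_betw_def f_inv_into_f)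
    show "\<psi> (\<lambda>i. if i < n then vec_index y (inv_into {..<n} \<tau> i) else 0) = y" if "y \<in> free_module R n" for y
      using that \<tau> \<tau>_less by (intro eq_vecI) (auto simp: \<psi>_def free_module_def bij_betw_def inv_into_f_f)
  qed
  have img: "\<psi> ` V n = free_module R n" and inj: "inj_on \<psi> (V n)" using bij by (auto simp: bij_betw_def)
  have mem: "\<psi> x \<in> \<psi> ` M \<longleftrightarrow> x \<in> M" if "M \<subseteq> V n" "x \<in> V n" for M x
    using inj_on_image_mem_iff[OF inj that(2,1)] .
  have ops: "\<psi> x + \<psi> y = \<psi> (x + y)" "\<psi> x - \<psi> y = \<psi> (x - y)" "a \<cdot>\<^sub>v \<psi> x = \<psi> (scl a x)" "0\<^sub>v n = \<psi> 0"
    for x y a by (auto simp: \<psi>_def scl_def)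
  have row: "row_mult (\<psi> x) A = \<psi> (x \<circ> h)" if "x \<in> V n" for x
    using A[rule_format, of "\<psi> x" x] that by (simp add: \<psi>_def V_def)
  have shift_closed: "x \<circ> h \<in> V n" if "x \<in> V n" for x
    using that shift_V[of n] V_mono[OF c_le[of n]] by blast
  have inv_iff: "invariant_submodule R A (\<psi> ` M) \<longleftrightarrow> submod M \<and> (\<forall>x\<in>M. x \<circ> h \<in> M)" if MV: "M \<subseteq> V n" for M
  proof -
    have "\<psi> ` M \<subseteq> free_module R n" using MV img by blast
    moreover have "0\<^sub>v n \<in> \<psi> ` M \<longleftrightarrow> 0 \<in> M" unfolding ops using mem[OF MV submod_0[OF submod_V]] .
    moreover have "(\<forall>x\<in>\<psi> ` M. \<forall>y\<in>\<psi> ` M. x + y \<in> \<psi> ` M) \<longleftrightarrow> (\<forall>x\<in>M. \<forall>y\<in>M. x + y \<in> M)"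
      using MV mem[OF MV submod_add[OF submod_V]] by (simp add: ops subset_iff)
    moreover have "(\<forall>a\<in>R. \<forall>x\<in>\<psi> ` M. a \<cdot>\<^sub>v x \<in> \<psi> ` M) \<longleftrightarrow> (\<forall>a\<in>R. \<forall>x\<in>M. scl a x \<in> M)"
      using MV mem[OF MV submod_scl[OF submod_V]] by (simp add: ops subset_iff)
    moreover have "(\<forall>x\<in>\<psi> ` M. row_mult x A \<in> \<psi> ` M) \<longleftrightarrow> (\<forall>x\<in>M. x \<circ> h \<in> M)"
      using MV row mem[OF MV shift_closed] by (simp add: subset_iff)
    ultimately show ?thesis unfolding invariant_submodule_def submod_def dim by blast
  qed
  have index: "bij_betw (image \<psi>) (V n // {(x, y). x \<in> V n \<and> y \<in> V n \<and> x - y \<in> M})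
      (free_module R n // {(x, y). x \<in> free_module R n \<and> y \<in> free_module R n \<and> x - y \<in> \<psi> ` M})"
    if MV: "M \<subseteq> V n" for M
  proof (rule bij_betw_quotient[OF bij])
    fix x y assume xy: "x \<in> V n" "y \<in> V n"
    then show "(\<psi> x, \<psi> y) \<in> {(x, y). x \<in> free_module R n \<and> y \<in> free_module R n \<and> x - y \<in> \<psi> ` M} \<longleftrightarrow>
        (x, y) \<in> {(x, y). x \<in> V n \<and> y \<in> V n \<and> x - y \<in> M}"
      using img mem[OF MV submod_diff[OF submod_V xy]] by (auto simp: ops)
  qed auto
  have index': "submodule_index R n (\<psi> ` M) = card (V n // {(x, y). x \<in> V n \<and> y \<in> V n \<and> x - y \<in> M})"
    if "M \<subseteq> V n" for M
    unfolding submodule_index_def using bij_betw_same_card[OF index[OF that]] by simp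
  have "bij_betw (image \<psi>) {M \<in> Lat n. q ^ colength n M = m} (invariant_submodules_of_index R A m)"
    unfolding bij_betw_def
  proof
    have LatV: "M \<subseteq> V n" if "M \<in> Lat n" for M using that full_rank_subset by (simp add: Lat_def)
    then have "{M \<in> Lat n. q ^ colength n M = m} \<subseteq> Pow (V n)" by auto
    then show "inj_on ((`) \<psi>) {M \<in> Lat n. q ^ colength n M = m}"
      by (rule inj_on_subset[OF inj_on_image_Pow[OF inj]])
    show "(`) \<psi> ` {M \<in> Lat n. q ^ colength n M = m} = invariant_submodules_of_index R A m"
    proof (intro equalityI subsetI)
      fix M' assume "M' \<in> (`) \<psi> ` {M \<in> Lat n. q ^ colength n M = m}"
      then obtain M where M: "M' = \<psi> ` M" "M \<in> Lat n" "q ^ colength n M = m" by blast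
      have MV: "M \<subseteq> V n" by (rule LatV[OF M(2)])
      have rank: "full_rank n M" and "\<forall>x\<in>M. x \<circ> h \<in> M" using M by (auto simp: Lat_def)
      then have "invariant_submodule R A M'" using inv_iff[OF MV] M full_rank_submod by blast
      moreover have "submodule_index R n M' = m"
        using index'[OF MV] card_quotient_full_rank[OF rank] M by (simp add: colength_def)
      ultimately show "M' \<in> invariant_submodules_of_index R A m"
        by (simp add: invariant_submodules_of_index_def dim)
    next
      fix M' assume "M' \<in> invariant_submodules_of_index R A m"
      then have M': "invariant_submodule R A M'" "submodule_index R n M' = m"
        by (simp_all add: invariant_submodules_of_index_def dim)
      define M where "M = {x \<in> V n. \<psi> x \<in> M'}"
      have MV: "M \<subseteq> V n" by (auto simp: M_def)
      have "M' \<subseteq> \<psi> ` V n" using M'(1) img by (simp add: invariant_submodule_def dim)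
      then have M'_eq: "M' = \<psi> ` M" by (auto simp: M_def)
      have sub: "submod M" "\<forall>x\<in>M. x \<circ> h \<in> M" using inv_iff[OF MV] M' M'_eq by auto
      have card: "card (V n // {(x, y). x \<in> V n \<and> y \<in> V n \<and> x - y \<in> M}) = m"
        using index'[OF MV] M' M'_eq by simp
      then have "finite (V n // {(x, y). x \<in> V n \<and> y \<in> V n \<and> x - y \<in> M})"
        using m by (intro card_ge_0_finite) simp
      then have rank: "full_rank n M" by (rule full_rank_if_finite_index[OF sub(1) MV])
      then have "M \<in> {M \<in> Lat n. q ^ colength n M = m}"
        using sub card card_quotient_full_rank[OF rank] by (simp add: Lat_def colength_def)
      then show "M' \<in> (`) \<psi> ` {M \<in> Lat n. q ^ colength n M = m}" using M'_eq by blast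
    qed
  qed
  then show ?thesis unfolding \<psi>_def .
qed

end

text \<open>Logarithms of positive integers are real, so no branch ambiguity arises.\<close>

lemma of_nat_power_powr:
  assumes "0 < q"
  shows "of_nat (q ^ N) powr s = (of_nat q powr s :: complex) ^ N"
proof -
  have "ln (real (q ^ N)) = real N * ln (real q)" using assms by (simp add: ln_realpow)
  then have "Ln (of_nat (q ^ N)) = of_nat N * Ln (of_nat q :: complex)"
    using assms by (simp add: Ln_of_nat del: of_nat_power)
  then show ?thesis
    using assms by (simp add: powr_def exp_of_nat_mult[symmetric] mult_ac)
qed

text \<open>The finiteness and convergence clauses show that the coefficients are genuine counts and
  the series a genuine sum on a half-plane, as \<open>card\<close> and \<open>suminf\<close> have
  default values otherwise. Only indices \<open>m = q ^ N\<close> contribute, which turns the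
  Dirichlet series into a power series in \<open>q powr (- s)\<close>.\<close>

theorem theorem4p1:
  fixes \<iota> :: "'p::prime_card padic \<Rightarrow> 'k::field"
    and v :: "'k \<Rightarrow> real"
    and n :: nat
    and l :: "nat list"
  assumes "n \<ge> 1"
    and "is_partition n l"
    and "padic_field \<iota> v"
  defines "R \<equiv> valuation_ring v"
    and "q \<equiv> residue_field_size v"
    and "A \<equiv> (nilpotent_matrix (dual_partition l) :: 'k mat)"
  shows "(\<forall>m\<ge>1. finite (invariant_submodules_of_index R A m)) \<and>
    (\<exists>\<sigma>::real. \<forall>s. Re s > \<sigma> \<longrightarrow> summable (submodule_zeta_term R A s)) \<and>
    (\<forall>s. summable (submodule_zeta_term R A s) \<longrightarrow>
      submodule_zeta R A s = W l (of_nat q) (of_nat q powr (- s)))"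
proof -
  interpret E: padic_extension \<iota> v
    using assms(3) by unfold_locales (auto simp: padic_field_def)
  obtain t where t: "0 < v t" "v t < 1" "\<And>x. v x < 1 \<Longrightarrow> v x \<le> v t" using E.ex_uniformizer by blast
  interpret P: partition l n by unfold_locales (use assms in auto)
  interpret N: nilpotent_shift v t P.shift
    by unfold_locales (use t E.finite_residue_field P.strict_mono_shift P.shift_gt in auto)
  define a where "a N = card {M \<in> N.Lat n. N.colength n M = N}" for N
  have q2: "2 \<le> q" unfolding q_def by (rule N.q_ge_2)
  have "dim_row A = n" unfolding A_def by (simp add: P.sum_dual_partition)
  obtain \<tau> where bij: "\<And>m. 1 \<le> m \<Longrightarrow> bij_betw (image (\<lambda>x. vec n (\<lambda>j. x (\<tau> j))))
      {M \<in> N.Lat n. q ^ N.colength n M = m} (invariant_submodules_of_index R A m)"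
  proof -
    obtain \<tau> where \<tau>: "bij_betw \<tau> {..<n} {..<n}"
      "\<forall>x\<in>carrier_vec n. \<forall>y. (\<forall>j<n. vec_index x j = y (\<tau> j)) \<longrightarrow> (\<forall>j\<ge>n. y j = 0) \<longrightarrow>
        row_mult x A = vec n (\<lambda>j. y (P.shift (\<tau> j)))"
      using P.ex_renumbering unfolding A_def by blast
    show ?thesis
      by (rule that) (unfold R_def q_def, rule N.bij_betw_invariant_submodules[OF \<tau>(1) \<open>dim_row A = n\<close> \<tau>(2)])
  qed
  define r where "r = 1 / real q ^ n"
  have r: "0 < r" using q2 by (simp add: r_def)
  have small: "real q ^ n * y < 1" if "y < r" for y
    using that q2 by (simp add: r_def field_simps)
  note series = N.colength_series[OF P.level_eq, folded q_def]
  have fin: "finite {M \<in> N.Lat n. N.colength n M = N}" for N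
    using series(1)[of "r / 2"] r small[of "r / 2"] by simp
  have a_sums: "(\<lambda>N. real (a N) * y ^ N) sums (\<Prod>i<n. 1 / (1 - real q ^ (n - Suc i) * y ^ P.level i))"
    if "0 < y" "y < r" for y
    unfolding a_def using series(2) that small by simp
  have power_eq: "{M \<in> N.Lat n. q ^ N.colength n M = q ^ N} = {M \<in> N.Lat n. N.colength n M = N}" for N
    using q2 by simp
  have finite_inv: "finite (invariant_submodules_of_index R A m)" if "1 \<le> m" for m
  proof -
    have "finite {M \<in> N.Lat n. q ^ N.colength n M = m}"
    proof (cases "\<exists>N. m = q ^ N")
      case True
      then show ?thesis using power_eq fin by auto
    next
      case False
      then have "{M \<in> N.Lat n. q ^ N.colength n M = m} = {}" by auto
      then show ?thesis by (metis finite.emptyI)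
    qed
    then show ?thesis using bij_betw_finite[OF bij[OF that]] by simp
  qed
  \<comment> \<open>The term with index \<open>k\<close> belongs to \<open>m = k + 1\<close>, hence
    the subtraction of 1.\<close>
  define g where "g N = q ^ N - 1" for N
  have Suc_g: "Suc (g N) = q ^ N" for N using q2 by (simp add: g_def)
  have g: "strict_mono g"
  proof (rule strict_monoI)
    fix M N :: nat assume "M < N"
    then have "q ^ M < q ^ N" using q2 by simp
    then show "g M < g N" using Suc_g[of M] Suc_g[of N] by linarith
  qed
  have term_0: "submodule_zeta_term R A s k = 0" if "k \<notin> range g" for s k
  proof -
    have "Suc k \<noteq> q ^ N" for N using that Suc_g[of N] by (metis Suc_inject rangeI)
    then have empty: "{M \<in> N.Lat n. q ^ N.colength n M = Suc k} = {}"
      by (metis (mono_tags, lifting) Collect_empty_eq)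
    have "card (invariant_submodules_of_index R A (Suc k)) = 0"
      using bij_betw_same_card[OF bij[of "Suc k"]] unfolding empty by simp
    then show ?thesis by (simp add: submodule_zeta_term_def)
  qed
  have term_g: "submodule_zeta_term R A s (g N) = of_real (real (a N)) * (of_nat q powr (- s)) ^ N" for s N
    using bij_betw_same_card[OF bij[of "q ^ N"]] q2
    unfolding submodule_zeta_term_def Suc_g a_def power_eq[symmetric]
    by (simp add: of_nat_power_powr del: of_nat_power)
  have sums_iff: "(\<lambda>N. of_real (real (a N)) * (of_nat q powr (- s)) ^ N) sums z \<longleftrightarrow>
      submodule_zeta_term R A s sums z" for s z
    using sums_mono_reindex[OF g, of "submodule_zeta_term R A s" z] term_0 term_g by simp
  have "summable (submodule_zeta_term R A s)" if "Re s > real (n + 1)" for s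
  proof -
    \<comment> \<open>A sample point inside \<open>(0, r)\<close>: \<open>q powr (- s)\<close> has
      absolute value below it precisely when the real part of \<open>s\<close> exceeds
      \<open>n + 1\<close>.\<close>
    define y where "y = 1 / real q ^ (n + 1)"
    have y: "0 < y" "y < r" using q2 by (simp_all add: y_def r_def field_simps)
    have "summable (\<lambda>N. complex_of_real (real (a N) * y ^ N))"
      using sums_of_real[OF a_sums[OF y]] by (rule sums_summable)
    then have "summable (\<lambda>N. of_real (real (a N)) * complex_of_real y ^ N)" by simp
    moreover have "norm (of_nat q powr (- s) :: complex) < norm (complex_of_real y)"
    proof -
      have "norm (of_nat q powr (- s) :: complex) = real q powr (- Re s)"
        using q2 norm_powr_real_powr[of "of_nat q" "- s"] by simp
      also have "\<dots> < real q powr (- real (n + 1))" using that q2 by simp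
      also have "\<dots> = y" using q2 by (simp only: powr_minus powr_realpow y_def) (simp add: divide_inverse)
      finally show ?thesis using y by simp
    qed
    ultimately have "summable (\<lambda>N. of_real (real (a N)) * (of_nat q powr (- s) :: complex) ^ N)"
      by (rule powser_inside)
    then show ?thesis using sums_iff unfolding summable_def by blast
  qed
  moreover have "submodule_zeta R A s = W l (of_nat q) (of_nat q powr (- s))"
    if "summable (submodule_zeta_term R A s)" for s
  proof -
    define z where "z = (of_nat q powr (- s) :: complex)"
    have sm: "summable (\<lambda>N. of_real (real (a N)) * z ^ N)"
      using that sums_iff unfolding summable_def z_def by blast
    have "submodule_zeta R A s = (\<Sum>N. of_real (real (a N)) * z ^ N)"
      using summable_sums[OF sm] sums_iff unfolding submodule_zeta_def z_def by (metis sums_unique)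
    also have "\<dots> = 1 / (\<Prod>i<n. 1 - of_real (real q ^ (n - Suc i)) * z ^ P.level i)"
      using a_sums series(3) small by (intro powser_eq_rational[OF _ r _ _ sm]) auto
    also have "(\<Prod>i<n. 1 - of_real (real q ^ (n - Suc i)) * z ^ P.level i) =
        (\<Prod>j = 1..sum_list l. 1 - of_nat q ^ (j - 1) * z ^ partition_inv l j)"
      \<comment> \<open>With \<open>j = n - i\<close> the exponent \<open>n - Suc i\<close> is
        \<open>j - 1\<close>, and \<open>level i\<close> is by definition
        \<open>partition_inv l j\<close>.\<close>
      by (rule prod.reindex_bij_witness[where i = "\<lambda>j. n - j" and j = "\<lambda>i. n - i"])
        (auto simp: P.level_def P.sum_l)
    finally show ?thesis by (simp add: W_def z_def)
  qed
  ultimately show ?thesis using finite_inv by blast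
qed

end
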